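(* Let $k$ and $n$ be integers with $n>k+1>2$. Let $H_1$ and $H_2$ be two graphs with disjoint vertex sets and $\max\{|V(H_1)|,|V(H_2)|\}\ge k+1$, and let $G\in [H_1,H_2]_k$ be a graph of order $n$. For each $i\in\{1,2\}$ let $V_i$ be the set of vertices of $H_i$ that are incident with the edges joining $H_1$ and $H_2$ in $G$. Then $G$ is $k$-edge-maximal if and only if one of the following holds: (i) for some $i\in\{1,2\}$, $H_i\cong K_1$ and $H_{3-i}$ is a $k$-edge-maximal graph; (ii) both $H_1$ and $H_2$ are $k$-edge-maximal graphs with at least $k+2$ vertices, and for each $i\in\{1,2\}$ there is a $k$-closure of $H_i[V_i]$ in $H_i$ that is not isomorphic to $K_{k+1}$.
   Context: All graphs are finite and simple. $G[S]$ denotes the subgraph of $G$ induced by $S$. An edge-cut of a graph is a set of edges whose removal increases the number of components; a $k$-edge-cut is an edge-cut of size $k$. The edge-connectivity $\kappa'(G)$ of a connected graph with at least two vertices is the minimum size of an edge-cut; $\kappa'(G)=0$ if $G$ is disconnected or $G\cong K_1$. The strength of $G$ is $\overline{\kappa}'(G)=\max_{H\subseteq G}\kappa'(H)$, the maximum over all (nonempty) subgraphs $H$ of $G$. A simple graph $G$ is $k$-edge-maximal if $\overline{\kappa}'(G)\le k$ but $\overline{\kappa}'(G+e)\ge k+1$ for every edge $e\notin E(G)$ (i.e. every edge $e$ of the complement of $G$). Convention: $k$-edge-maximal graphs are understood to have at least $k+1$ vertices. $k$-edge-join: for graphs $H_1,H_2$ with disjoint vertex sets and $\max\{|V(H_1)|,|V(H_2)|\}\ge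 k+1$, a $k$-edge-join of $H_1$ and $H_2$ is a simple graph obtained from the disjoint union of $H_1$ and $H_2$ by adding $k$ new (distinct) edges, each joining a vertex of $H_1$ to a vertex of $H_2$. The set of all $k$-edge-joins of $H_1$ and $H_2$ is denoted $[H_1,H_2]_k$. $k$-kernel: let $G$ and $H$ be $k$-edge-maximal graphs with $H$ a subgraph of $G$. $H$ is a $k$-kernel of $G$ if $H$ can be obtained from $G$ by recursively deleting a $k$-edge-cut of a remaining component, i.e. there is a sequence $G=G_1,G_2,\dots,G_s=H$ ($s\ge1$) such that $G_{i+1}$ is a component of $G_i-X_i$ for some $k$-edge-cut $X_i$ of $G_i$, $1\le i\le s-1$ (equivalently, $G$ can be obtained from $H$ via some $k$-edge-join operations). In particular $G$ is a $k$-kernel of itself. $k$-closure: let $G$ be a $k$-edge-maximal graph and $H$ a subgraph of $G$. A $k$-closure of $H$ in $G$ is a minimal (with respect to subgraph inclusion) $k$-kernel of $G$ that contains $H$ as a subgraph. *)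

theory Defs
  imports Main
begin

section \<open>Finite simple graphs\<close>

datatype 'a graph = Graph (verts: "'a set") (edges: "'a set set")

definition simple_graph :: "'a graph \<Rightarrow> bool" where
  "simple_graph G \<longleftrightarrow> finite (verts G) \<and> (\<forall>e\<in>edges G. e \<subseteq> verts G \<and> card e = 2)"

definition subgraph :: "'a graph \<Rightarrow> 'a graph \<Rightarrow> bool" where
  "subgraph H G \<longleftrightarrow>
     simple_graph H \<and> simple_graph G \<and> verts H \<subseteq> verts G \<and> edges H \<subseteq> edges G"

definition induced_subgraph :: "'a graph \<Rightarrow> 'a set \<Rightarrow> 'a graph" where
  "induced_subgraph G S = Graph S {e \<in> edges G. e \<subseteq> S}"

definition graph_iso :: "'a graph \<Rightarrow> 'b graph \<Rightarrow> bool" where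
  "graph_iso G H \<longleftrightarrow> (\<exists>f. bij_betw f (verts G) (verts H) \<and>
     (\<forall>u\<in>verts G. \<forall>v\<in>verts G. {u, v} \<in> edges G \<longleftrightarrow> {f u, f v} \<in> edges H))"

definition complete_graph :: "nat \<Rightarrow> nat graph" where
  "complete_graph m = Graph {..<m} {{i, j} | i j. i < m \<and> j < m \<and> i \<noteq> j}"

definition delete_edges :: "'a graph \<Rightarrow> 'a set set \<Rightarrow> 'a graph" where
  "delete_edges G X = Graph (verts G) (edges G - X)"

definition add_edge :: "'a graph \<Rightarrow> 'a set \<Rightarrow> 'a graph" where
  "add_edge G e = Graph (verts G) (insert e (edges G))"

section \<open>Connectivity, edge-cuts and strength\<close>

definition conn_rel :: "'a graph \<Rightarrow> ('a \<times> 'a) set" where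
  "conn_rel G = {(u, v). u \<in> verts G \<and> v \<in> verts G \<and> (u, v) \<in> {(x, y). {x, y} \<in> edges G}\<^sup>*}"

definition graph_components :: "'a graph \<Rightarrow> 'a graph set" where
  "graph_components G = induced_subgraph G ` (verts G // conn_rel G)"

definition connected_graph :: "'a graph \<Rightarrow> bool" where
  "connected_graph G \<longleftrightarrow> verts G \<noteq> {} \<and> (\<forall>u\<in>verts G. \<forall>v\<in>verts G. (u, v) \<in> conn_rel G)"

definition edge_cut :: "'a graph \<Rightarrow> 'a set set \<Rightarrow> bool" where
  "edge_cut G X \<longleftrightarrow> X \<subseteq> edges G \<and>
     card (graph_components (delete_edges G X)) > card (graph_components G)"

definition edge_connectivity :: "'a graph \<Rightarrow> nat" where
  "edge_connectivity G =
     (if connected_graph G \<and> card (verts G) \<ge> 2 then Min {card X | X. edge_cut G X} else 0)"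

definition strength :: "'a graph \<Rightarrow> nat" where
  "strength G = Max {edge_connectivity H | H. subgraph H G \<and> verts H \<noteq> {}}"

section \<open>Edge-maximal graphs, edge-joins, kernels and closures\<close>

text \<open>The bound on the number of vertices is the usual convention for
  \<open>k\<close>-edge-maximal graphs; without it every complete graph on at most \<open>k\<close> vertices
  would qualify.\<close>

definition edge_maximal :: "nat \<Rightarrow> 'a graph \<Rightarrow> bool" where
  "edge_maximal k G \<longleftrightarrow> simple_graph G \<and> card (verts G) \<ge> k + 1 \<and> strength G \<le> k \<and>
     (\<forall>u\<in>verts G. \<forall>v\<in>verts G. u \<noteq> v \<and> {u, v} \<notin> edges G \<longrightarrow>
        strength (add_edge G {u, v}) \<ge> k + 1)"

definition edge_joins :: "nat \<Rightarrow> 'a graph \<Rightarrow> 'a graph \<Rightarrow> 'a graph set" where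
  "edge_joins k H1 H2 = {Graph (verts H1 \<union> verts H2) (edges H1 \<union> edges H2 \<union> F) | F.
     simple_graph H1 \<and> simple_graph H2 \<and> verts H1 \<inter> verts H2 = {} \<and>
     max (card (verts H1)) (card (verts H2)) \<ge> k + 1 \<and>
     F \<subseteq> {{u, v} | u v. u \<in> verts H1 \<and> v \<in> verts H2} \<and> card F = k}"

definition attachment_verts :: "'a graph \<Rightarrow> 'a graph \<Rightarrow> 'a graph \<Rightarrow> 'a set" where
  "attachment_verts G H H' = {v \<in> verts H. \<exists>w\<in>verts H'. {v, w} \<in> edges G}"

definition kernel_step :: "nat \<Rightarrow> 'a graph \<Rightarrow> 'a graph \<Rightarrow> bool" where
  "kernel_step k G G' \<longleftrightarrow>
     (\<exists>X. edge_cut G X \<and> card X = k \<and> G' \<in> graph_components (delete_edges G X))"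

definition is_kernel :: "nat \<Rightarrow> 'a graph \<Rightarrow> 'a graph \<Rightarrow> bool" where
  "is_kernel k H G \<longleftrightarrow>
     edge_maximal k G \<and> edge_maximal k H \<and> subgraph H G \<and> (kernel_step k)\<^sup>*\<^sup>* G H"

text \<open>\<open>is_closure k C H G\<close>: \<open>C\<close> is a \<open>k\<close>-closure of \<open>H\<close> in \<open>G\<close>. Minimality is with respect
  to inclusion, so closures need not be unique.\<close>

definition is_closure :: "nat \<Rightarrow> 'a graph \<Rightarrow> 'a graph \<Rightarrow> 'a graph \<Rightarrow> bool" where
  "is_closure k C H G \<longleftrightarrow> edge_maximal k G \<and> subgraph H G \<and>
     is_kernel k C G \<and> subgraph H C \<and>
     (\<forall>D. is_kernel k D G \<and> subgraph H D \<and> subgraph D C \<longrightarrow> D = C)"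

end

theory Submission
  imports Defs
begin

text \<open>
  Everything is expressed through the edges of an induced subgraph \<open>G[S]\<close> that leave a vertex set
  \<open>T \<subset> S\<close>, its \<^emph>\<open>crossing\<close> edges. A graph with at least two vertices has edge-connectivity at least
  \<open>m\<close> iff each such \<open>T\<close> is crossed by at least \<open>m\<close> edges, and adding edges to a subgraph does not
  lower its connectivity, so the strength only depends on induced subgraphs. Hence \<open>G\<close>, with at
  least \<open>k + 1\<close> vertices, is \<open>k\<close>-edge-maximal iff each \<open>S\<close> with at least two vertices has a cut of at most \<open>k\<close> edges while each
  non-adjacent pair \<open>u\<close>, \<open>v\<close> is \<^emph>\<open>linked\<close> by some \<open>S\<close>, meaning that \<open>G[S] + uv\<close> is
  \<open>(k + 1)\<close>-edge-connected (\<open>edge_maximal_iff\<close>).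

  For a \<open>k\<close>-edge-maximal \<open>G\<close> on more than \<open>k + 1\<close> vertices and a cut of \<open>k\<close> edges between \<open>A\<close> and
  its complement, two facts about a linking set \<open>S\<close> do most of the work. If \<open>u\<close> and \<open>v\<close> lie on one
  side of the cut then so does \<open>S\<close>, because the pair does not help across the cut; so each side
  inherits edge-maximality as soon as it is large enough. If they lie on different sides then all
  \<open>k\<close> cut edges are inside \<open>S\<close>, and counting degrees shows that \<open>S \<inter> A\<close> is a single vertex or has
  at least \<open>k + 1\<close> vertices, where \<open>k + 1\<close> is only possible in a rigid situation
  (\<open>linked_side_card\<close>). It follows that a side is a single vertex or \<open>k\<close>-edge-maximal
  (\<open>edge_maximal_side\<close>).

  For necessity, let a kernel \<open>Q\<close> of \<open>G[A]\<close> contain all ends in \<open>A\<close> of the cut edges. The linking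
  sets for \<open>u \<in> Q\<close> and \<open>v \<notin> A\<close> cannot reach beyond \<open>Q\<close> in \<open>A\<close>, since each deletion on the way from
  \<open>G[A]\<close> to \<open>Q\<close> cuts off a part with only \<open>k\<close> edges (\<open>subset_kernel\<close>). If \<open>Q\<close> had \<open>k + 1\<close>
  vertices then the rigid situation would occur, and a suitable choice of \<open>u\<close> contradicts it
  (\<open>kernel_at_attach_card\<close>). So no closure is a \<open>K\<^bsub>k+1\<^esub>\<close>, and neither
  is a side with at least two vertices.

  For sufficiency, \<open>u\<close> and \<open>v\<close> on different sides are linked by a union \<open>S\<^sub>1 \<union> S\<^sub>2\<close>, one set on each
  side, if \<open>S\<^sub>1\<close> is \<^emph>\<open>anchored\<close> at \<open>u\<close> and the ends of the cut edges: all its cuts have at least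
  \<open>k\<close> edges, and at least \<open>k + 1\<close> if the part cut off avoids these vertices; likewise for \<open>S\<^sub>2\<close>
  (\<open>linked_union\<close>). Such sets come from minimal kernels. For a side that is more than a vertex, start
  from a closure \<open>C\<close> with at least \<open>k + 2\<close> vertices and take a smallest kernel \<open>P\<close> containing \<open>C\<close>
  and \<open>u\<close>. If \<open>P\<close> is not anchored, then minimality of \<open>P\<close> and of \<open>C\<close> force all cut edges to end
  in one vertex \<open>x\<close>, and then edge-maximality of \<open>P\<close> itself provides an anchored set
  (\<open>anchored_closure\<close>).
\<close>

section \<open>Crossing edges\<close>

text \<open>The edges of the cut of \<open>G[S]\<close> given by \<open>T\<close>. The set \<open>T\<close> need not be contained in \<open>S\<close>.\<close>

definition crossing :: "'a graph \<Rightarrow> 'a set \<Rightarrow> 'a set \<Rightarrow> 'a set set" where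
  "crossing G S T = {e \<in> edges G. e \<subseteq> S \<and> e \<inter> T \<noteq> {} \<and> \<not> e \<subseteq> T}"

lemma simple_graph_finite_edges: "simple_graph G \<Longrightarrow> finite (edges G)"
  unfolding simple_graph_def by (meson Pow_iff finite_Pow_iff finite_subset subsetI)

lemma finite_crossing: "simple_graph G \<Longrightarrow> finite (crossing G S T)"
  using simple_graph_finite_edges unfolding crossing_def by (metis (no_types, lifting) finite_subset mem_Collect_eq subsetI)

lemma edge_endpoints:
  assumes "simple_graph G" "e \<in> edges G"
  obtains x y where "e = {x, y}" "x \<noteq> y" "x \<in> verts G" "y \<in> verts G"
  using assms unfolding simple_graph_def by (metis card_2_iff insert_subset)

lemma crossing_endpoints:
  assumes "simple_graph G" "e \<in> crossing G S T"
  obtains x y where "e = {x, y}" "x \<in> T" "y \<notin> T" "x \<in> S" "y \<in> S"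
proof -
  from assms have "e \<in> edges G" and e: "e \<subseteq> S" "e \<inter> T \<noteq> {}" "\<not> e \<subseteq> T"
    by (auto simp: crossing_def)
  then obtain a b where ab: "e = {a, b}" using assms(1) edge_endpoints by metis
  then consider "a \<in> T" "b \<notin> T" | "b \<in> T" "a \<notin> T" using e by blast
  then show thesis
  proof cases
    case 1 then show thesis using that[of a b] ab e by auto
  next
    case 2 then show thesis using that[of b a] ab e by auto
  qed
qed

lemma crossing_pairI:
  "{x, y} \<in> edges G \<Longrightarrow> x \<in> S \<Longrightarrow> y \<in> S \<Longrightarrow> x \<in> T \<Longrightarrow> y \<notin> T \<Longrightarrow> {x, y} \<in> crossing G S T"
  by (auto simp: crossing_def)

lemma crossing_complement: "T \<subseteq> S \<Longrightarrow> crossing G S (S - T) = crossing G S T"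
  unfolding crossing_def by blast

lemma crossing_mono: "S \<subseteq> S' \<Longrightarrow> edges G \<subseteq> edges G' \<Longrightarrow> crossing G S (T \<inter> S) \<subseteq> crossing G' S' T"
  unfolding crossing_def by blast

lemma crossing_induced: "S \<subseteq> U \<Longrightarrow> crossing (induced_subgraph G U) S T = crossing G S T"
  unfolding crossing_def induced_subgraph_def by auto

lemma simple_graph_induced: "simple_graph G \<Longrightarrow> U \<subseteq> verts G \<Longrightarrow> simple_graph (induced_subgraph G U)"
  unfolding simple_graph_def induced_subgraph_def by (auto intro: finite_subset)

lemma verts_induced [simp]: "verts (induced_subgraph G U) = U"
  by (simp add: induced_subgraph_def)

section \<open>Connectedness, edge-cuts and strength through crossing edges\<close>

lemma equiv_conn_rel: "equiv (verts G) (conn_rel G)"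
proof (rule equivI)
  let ?E = "{(x, y). {x, y} \<in> edges G}"
  show "conn_rel G \<subseteq> verts G \<times> verts G" "refl_on (verts G) (conn_rel G)"
    by (auto simp: conn_rel_def refl_on_def)
  have "sym (?E\<^sup>*)" by (rule sym_rtrancl) (auto simp: sym_def insert_commute)
  then show "sym (conn_rel G)" by (auto simp: conn_rel_def sym_def)
  show "trans (conn_rel G)" by (auto simp: conn_rel_def trans_def)
qed

text \<open>A path that starts in \<open>T\<close> and never uses a crossing edge stays in \<open>T\<close>; conversely the vertices
  reachable from a vertex form a set that no edge crosses.\<close>

lemma connected_graph_iff_crossing:
  assumes "simple_graph G" "verts G \<noteq> {}"
  shows "connected_graph G \<longleftrightarrow> (\<forall>T. T \<subset> verts G \<and> T \<noteq> {} \<longrightarrow> crossing G (verts G) T \<noteq> {})"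
proof (intro iffI allI impI)
  fix T assume con: "connected_graph G" and T: "T \<subset> verts G \<and> T \<noteq> {}"
  then obtain u v where uv: "u \<in> T" "v \<in> verts G" "v \<notin> T" by blast
  then have path: "(u, v) \<in> {(x, y). {x, y} \<in> edges G}\<^sup>*"
    using con T unfolding connected_graph_def conn_rel_def by blast
  show "crossing G (verts G) T \<noteq> {}"
  proof
    assume empty: "crossing G (verts G) T = {}"
    from path have "v \<in> T"
    proof induction
      case (step y z)
      then have "{y, z} \<in> edges G" "{y, z} \<subseteq> verts G"
        using assms(1) unfolding simple_graph_def by auto
      then show ?case using step empty crossing_pairI[of y z G "verts G" T] by auto
    qed (use uv in auto)
    with uv show False by simp
  qed
next
  assume R: "\<forall>T. T \<subset> verts G \<and> T \<noteq> {} \<longrightarrow> crossing G (verts G) T \<noteq> {}"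
  have "(u, v) \<in> conn_rel G" if uv: "u \<in> verts G" "v \<in> verts G" for u v
  proof (rule ccontr)
    assume no: "(u, v) \<notin> conn_rel G"
    let ?T = "conn_rel G `` {u}"
    have "u \<in> ?T" using uv by (simp add: conn_rel_def)
    moreover have "?T \<subseteq> verts G" by (auto simp: conn_rel_def)
    ultimately obtain e where "e \<in> crossing G (verts G) ?T" using R no uv by blast
    then obtain x y where xy: "e = {x, y}" "x \<in> ?T" "y \<notin> ?T" "y \<in> verts G"
      by (elim crossing_endpoints[OF assms(1)])
    moreover have "e \<in> edges G" using \<open>e \<in> crossing G (verts G) ?T\<close> by (simp add: crossing_def)
    ultimately have "(u, x) \<in> {(x, y). {x, y} \<in> edges G}\<^sup>*" "{x, y} \<in> edges G"
      by (auto simp: conn_rel_def)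
    then have "(u, y) \<in> conn_rel G"
      using uv xy(4) by (simp add: conn_rel_def rtrancl.rtrancl_into_rtrancl)
    with xy show False by auto
  qed
  then show "connected_graph G" using assms(2) by (simp add: connected_graph_def)
qed

lemma card_graph_components:
  "card (graph_components G) = card (verts G // conn_rel G)"
proof -
  have "inj_on (induced_subgraph G) X" for X by (rule inj_onI) (metis verts_induced)
  then show ?thesis unfolding graph_components_def by (rule card_image)
qed

lemma connected_graph_iff_card_components:
  assumes "simple_graph G" "verts G \<noteq> {}"
  shows "connected_graph G \<longleftrightarrow> card (graph_components G) \<le> 1"
proof -
  let ?Q = "verts G // conn_rel G"
  have fin: "finite ?Q"
    using assms(1) by (auto simp: simple_graph_def conn_rel_def intro: finite_quotient)
  have "(u, v) \<in> conn_rel G \<longleftrightarrow> conn_rel G `` {u} = conn_rel G `` {v}"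
    if "u \<in> verts G" "v \<in> verts G" for u v
    using eq_equiv_class_iff[OF equiv_conn_rel that] by simp
  then have "connected_graph G \<longleftrightarrow> (\<forall>X\<in>?Q. \<forall>Y\<in>?Q. X = Y)"
    using assms(2) by (simp add: connected_graph_def quotient_def)
  also have "\<dots> \<longleftrightarrow> card ?Q \<le> 1"
    using card_le_Suc0_iff_eq[OF fin] by simp
  finally show ?thesis by (simp add: card_graph_components)
qed

lemma simple_graph_delete_edges: "simple_graph G \<Longrightarrow> simple_graph (delete_edges G X)"
  by (simp add: simple_graph_def delete_edges_def)

text \<open>An edge-cut may contain superfluous edges, but deleting it isolates some \<open>T\<close> from the rest. This is
  why the smallest edge-cuts are cuts of vertex sets.\<close>

lemma edge_cut_iff_crossing:
  assumes "simple_graph G" "connected_graph G"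
  shows "edge_cut G X \<longleftrightarrow>
    X \<subseteq> edges G \<and> (\<exists>T. T \<subset> verts G \<and> T \<noteq> {} \<and> crossing G (verts G) T \<subseteq> X)"
proof -
  let ?D = "delete_edges G X"
  have V: "verts ?D = verts G" "verts G \<noteq> {}"
    using assms(2) by (auto simp: delete_edges_def connected_graph_def)
  have sD: "simple_graph ?D" using assms(1) by (rule simple_graph_delete_edges)
  have "finite (verts G // conn_rel G)" "verts G // conn_rel G \<noteq> {}"
    using assms(1) V by (auto simp: simple_graph_def conn_rel_def intro: finite_quotient)
  then have "card (graph_components G) = 1"
    using connected_graph_iff_card_components[OF assms(1) V(2)] assms(2)
    by (metis card_0_eq card_graph_components le_antisym less_one not_le)
  then have "card (graph_components ?D) > card (graph_components G) \<longleftrightarrow> \<not> connected_graph ?D"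
    using connected_graph_iff_card_components[OF sD] V by auto
  also have "\<dots> \<longleftrightarrow> (\<exists>T. T \<subset> verts G \<and> T \<noteq> {} \<and> crossing ?D (verts G) T = {})"
    using connected_graph_iff_crossing[OF sD] V by auto
  also have "\<dots> \<longleftrightarrow> (\<exists>T. T \<subset> verts G \<and> T \<noteq> {} \<and> crossing G (verts G) T \<subseteq> X)"
  proof -
    have "crossing ?D (verts G) T = crossing G (verts G) T - X" for T
      by (auto simp: crossing_def delete_edges_def)
    then show ?thesis by simp
  qed
  finally show ?thesis by (simp add: edge_cut_def)
qed

text \<open>Positivity of \<open>m\<close> absorbs the default value \<open>0\<close> of graphs that are disconnected or have at most one
  vertex.\<close>

lemma le_edge_connectivity_iff:
  assumes "simple_graph G" "0 < m"
  shows "m \<le> edge_connectivity G \<longleftrightarrow> 2 \<le> card (verts G) \<and>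
    (\<forall>T. T \<subset> verts G \<and> T \<noteq> {} \<longrightarrow> m \<le> card (crossing G (verts G) T))"
proof (cases "connected_graph G \<and> 2 \<le> card (verts G)")
  case True
  then have con: "connected_graph G" and two: "2 \<le> card (verts G)" by auto
  let ?C = "{card X | X. edge_cut G X}"
  obtain x where x: "x \<in> verts G" using con by (auto simp: connected_graph_def)
  have "{x} \<subset> verts G" using x two by (metis One_nat_def Suc_1 bot_least card_1_singleton_iff insert_subset not_less_eq_eq order_refl psubsetI)
  then have "edge_cut G (edges G)"
    unfolding edge_cut_iff_crossing[OF assms(1) con] by (intro conjI exI[of _ "{x}"]) (auto simp: crossing_def)
  then have "?C \<noteq> {}" by blast
  moreover have "?C \<subseteq> card ` Pow (edges G)" unfolding edge_cut_def by blast
  then have "finite ?C"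
    by (rule finite_subset) (simp add: simple_graph_finite_edges[OF assms(1)])
  ultimately have "m \<le> Min ?C \<longleftrightarrow> (\<forall>c\<in>?C. m \<le> c)" by (intro Min_ge_iff)
  then have "m \<le> edge_connectivity G \<longleftrightarrow> (\<forall>X. edge_cut G X \<longrightarrow> m \<le> card X)"
    using True unfolding edge_connectivity_def by (simp only: simp_thms if_True) blast
  also have "\<dots> \<longleftrightarrow> (\<forall>T. T \<subset> verts G \<and> T \<noteq> {} \<longrightarrow> m \<le> card (crossing G (verts G) T))"
  proof (intro iffI allI impI)
    fix T assume "\<forall>X. edge_cut G X \<longrightarrow> m \<le> card X" "T \<subset> verts G \<and> T \<noteq> {}"
    moreover have "crossing G (verts G) T \<subseteq> edges G" by (auto simp: crossing_def)
    ultimately show "m \<le> card (crossing G (verts G) T)"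
      unfolding edge_cut_iff_crossing[OF assms(1) con] by blast
  next
    fix X assume R: "\<forall>T. T \<subset> verts G \<and> T \<noteq> {} \<longrightarrow> m \<le> card (crossing G (verts G) T)"
      and "edge_cut G X"
    then obtain T where T: "T \<subset> verts G" "T \<noteq> {}" "crossing G (verts G) T \<subseteq> X" "X \<subseteq> edges G"
      unfolding edge_cut_iff_crossing[OF assms(1) con] by blast
    then have "finite X" using simple_graph_finite_edges[OF assms(1)] finite_subset by blast
    then show "m \<le> card X" using R T card_mono le_trans by metis
  qed
  finally show ?thesis using two by blast
next
  case False
  have "connected_graph G" if "2 \<le> card (verts G)"
    "\<forall>T. T \<subset> verts G \<and> T \<noteq> {} \<longrightarrow> m \<le> card (crossing G (verts G) T)"
  proof -
    have "verts G \<noteq> {}" using that(1) by auto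
    then show ?thesis
      unfolding connected_graph_iff_crossing[OF assms(1) \<open>verts G \<noteq> {}\<close>]
      using that(2) assms(2) by (metis card.empty not_le)
  qed
  moreover have "edge_connectivity G = 0" using False by (auto simp: edge_connectivity_def)
  ultimately show ?thesis using False assms(2) by auto
qed

text \<open>Replacing a subgraph by the induced subgraph on the same vertices only adds crossing edges, so the
  maximum is attained by induced subgraphs.\<close>

lemma le_strength_iff:
  assumes "simple_graph G" "verts G \<noteq> {}" "0 < m"
  shows "m \<le> strength G \<longleftrightarrow> (\<exists>S. S \<subseteq> verts G \<and> 2 \<le> card S \<and>
    (\<forall>T. T \<subset> S \<and> T \<noteq> {} \<longrightarrow> m \<le> card (crossing G S T)))"
proof -
  let ?C = "{edge_connectivity H | H. subgraph H G \<and> verts H \<noteq> {}}"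
  have "{H. subgraph H G} \<subseteq> (\<lambda>(V, E). Graph V E) ` (Pow (verts G) \<times> Pow (edges G))"
  proof
    fix H assume "H \<in> {H. subgraph H G}"
    then show "H \<in> (\<lambda>(V, E). Graph V E) ` (Pow (verts G) \<times> Pow (edges G))"
      by (cases H) (auto simp: subgraph_def)
  qed
  then have "finite {H. subgraph H G}"
    by (rule finite_surj[rotated])
      (use assms(1) simple_graph_finite_edges in \<open>auto simp: simple_graph_def\<close>)
  moreover have "?C \<subseteq> edge_connectivity ` {H. subgraph H G}" by auto
  ultimately have "finite ?C" using finite_surj by blast
  moreover have "?C \<noteq> {}" using assms by (auto simp: subgraph_def)
  ultimately have "m \<le> strength G \<longleftrightarrow> (\<exists>H. subgraph H G \<and> verts H \<noteq> {} \<and> m \<le> edge_connectivity H)"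
    by (auto simp: strength_def Max_ge_iff)
  also have "\<dots> \<longleftrightarrow> (\<exists>S. S \<subseteq> verts G \<and> 2 \<le> card S \<and>
      (\<forall>T. T \<subset> S \<and> T \<noteq> {} \<longrightarrow> m \<le> card (crossing G S T)))"
  proof
    assume "\<exists>H. subgraph H G \<and> verts H \<noteq> {} \<and> m \<le> edge_connectivity H"
    then obtain H where H: "subgraph H G" "m \<le> edge_connectivity H" by blast
    then have sH: "simple_graph H" by (simp add: subgraph_def)
    have "m \<le> card (crossing G (verts H) T)" if "T \<subset> verts H" "T \<noteq> {}" for T
    proof -
      have "m \<le> card (crossing H (verts H) T)"
        using H that le_edge_connectivity_iff[OF sH assms(3)] by blast
      also have "\<dots> \<le> card (crossing G (verts H) T)"
        using H(1) finite_crossing[OF assms(1)]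
        by (intro card_mono) (auto simp: crossing_def subgraph_def)
      finally show ?thesis .
    qed
    then show "\<exists>S. S \<subseteq> verts G \<and> 2 \<le> card S \<and>
      (\<forall>T. T \<subset> S \<and> T \<noteq> {} \<longrightarrow> m \<le> card (crossing G S T))"
      using H le_edge_connectivity_iff[OF sH assms(3)] by (auto simp: subgraph_def)
  next
    assume "\<exists>S. S \<subseteq> verts G \<and> 2 \<le> card S \<and>
      (\<forall>T. T \<subset> S \<and> T \<noteq> {} \<longrightarrow> m \<le> card (crossing G S T))"
    then obtain S where S: "S \<subseteq> verts G" "2 \<le> card S"
      "\<forall>T. T \<subset> S \<and> T \<noteq> {} \<longrightarrow> m \<le> card (crossing G S T)" by blast
    have "m \<le> edge_connectivity (induced_subgraph G S)"
      using S by (simp add: le_edge_connectivity_iff simple_graph_induced assms crossing_induced)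
    moreover have "subgraph (induced_subgraph G S) G"
      using S simple_graph_induced[OF assms(1) S(1)] assms(1)
      unfolding subgraph_def by (simp add: induced_subgraph_def)
    moreover have "S \<noteq> {}" using S(2) by auto
    ultimately show "\<exists>H. subgraph H G \<and> verts H \<noteq> {} \<and> m \<le> edge_connectivity H"
      by (metis verts_induced)
  qed
  finally show ?thesis .
qed

section \<open>Edge-maximality through crossing edges\<close>

text \<open>For non-adjacent \<open>u\<close> and \<open>v\<close> this says that \<open>G[S] + uv\<close> is \<open>(k + 1)\<close>-edge-connected: the new edge
  contributes to the cut of \<open>T\<close> exactly if \<open>T\<close> separates \<open>u\<close> from \<open>v\<close>.\<close>

definition linked :: "nat \<Rightarrow> 'a graph \<Rightarrow> 'a \<Rightarrow> 'a \<Rightarrow> 'a set \<Rightarrow> bool" where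
  "linked k G u v S \<longleftrightarrow> S \<subseteq> verts G \<and> u \<in> S \<and> v \<in> S \<and>
     (\<forall>T. T \<subset> S \<and> T \<noteq> {} \<longrightarrow>
        k + 1 \<le> card (crossing G S T) + (if u \<in> T \<longleftrightarrow> v \<in> T then 0 else 1))"

lemma crossing_add_edge:
  assumes "T \<subseteq> S"
  shows "crossing (add_edge G {u, v}) S T =
    crossing G S T \<union> (if u \<in> S \<and> v \<in> S \<and> \<not> (u \<in> T \<longleftrightarrow> v \<in> T) then {{u, v}} else {})"
  using assms unfolding crossing_def add_edge_def by auto

lemma card_crossing_add_edge:
  assumes "simple_graph G" "{u, v} \<notin> edges G" "T \<subseteq> S" "u \<in> S" "v \<in> S"
  shows "card (crossing (add_edge G {u, v}) S T) =
    card (crossing G S T) + (if u \<in> T \<longleftrightarrow> v \<in> T then 0 else 1)"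
proof -
  have "{u, v} \<notin> crossing G S T" using assms(2) by (simp add: crossing_def)
  then show ?thesis
    using assms finite_crossing[OF assms(1)] by (simp add: crossing_add_edge)
qed

text \<open>A \<open>(k + 1)\<close>-edge-connected subgraph of \<open>G + uv\<close> has to use the new edge, since \<open>G\<close> has none.\<close>

lemma le_strength_add_edge_iff:
  assumes "simple_graph G" "u \<in> verts G" "v \<in> verts G" "u \<noteq> v" "{u, v} \<notin> edges G"
    and "strength G \<le> k"
  shows "k + 1 \<le> strength (add_edge G {u, v}) \<longleftrightarrow> (\<exists>S. linked k G u v S)"
proof -
  let ?G = "add_edge G {u, v}"
  have V: "verts ?G = verts G" by (simp add: add_edge_def)
  have s: "simple_graph ?G" using assms by (simp add: simple_graph_def add_edge_def)
  have ne: "verts G \<noteq> {}" and pos: "0 < k + 1" using assms by auto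
  have finV: "finite (verts G)" using assms(1) by (simp add: simple_graph_def)
  have tight: "2 \<le> card S \<and> (\<forall>T. T \<subset> S \<and> T \<noteq> {} \<longrightarrow> k + 1 \<le> card (crossing ?G S T)) \<longleftrightarrow>
      linked k G u v S" if S: "S \<subseteq> verts G" for S
  proof (cases "u \<in> S \<and> v \<in> S")
    case True
    have "card {u, v} \<le> card S"
      using True finite_subset[OF S finV] by (intro card_mono) auto
    then have "2 \<le> card S" using assms(4) by simp
    moreover have "card (crossing ?G S T) = card (crossing G S T) + (if u \<in> T \<longleftrightarrow> v \<in> T then 0 else 1)"
      if "T \<subset> S" for T
      using card_crossing_add_edge[OF assms(1,5)] True that by blast
    ultimately show ?thesis using True S unfolding linked_def by (simp cong: conj_cong)
  next
    case False
    then have "crossing ?G S T = crossing G S T" if "T \<subset> S" for T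
      using that False crossing_add_edge[of T S G u v] by auto
    moreover have "\<not> (\<exists>S. S \<subseteq> verts G \<and> 2 \<le> card S \<and>
        (\<forall>T. T \<subset> S \<and> T \<noteq> {} \<longrightarrow> k + 1 \<le> card (crossing G S T)))"
      using assms(6) unfolding le_strength_iff[OF assms(1) ne pos, symmetric] by simp
    ultimately show ?thesis using False S unfolding linked_def by (metis (no_types, lifting))
  qed
  have "k + 1 \<le> strength ?G \<longleftrightarrow> (\<exists>S. S \<subseteq> verts G \<and> 2 \<le> card S \<and>
      (\<forall>T. T \<subset> S \<and> T \<noteq> {} \<longrightarrow> k + 1 \<le> card (crossing ?G S T)))"
    using le_strength_iff[OF s _ pos] ne unfolding V by blast
  also have "\<dots> \<longleftrightarrow> (\<exists>S. S \<subseteq> verts G \<and> linked k G u v S)" using tight by blast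
  also have "\<dots> \<longleftrightarrow> (\<exists>S. linked k G u v S)" unfolding linked_def by blast
  finally show ?thesis .
qed

text \<open>The characterization through which edge-maximality is used and proved from here on.\<close>

lemma edge_maximal_iff:
  "edge_maximal k G \<longleftrightarrow> simple_graph G \<and> k + 1 \<le> card (verts G) \<and>
    (\<forall>S. S \<subseteq> verts G \<and> 2 \<le> card S \<longrightarrow> (\<exists>T. T \<subset> S \<and> T \<noteq> {} \<and> card (crossing G S T) \<le> k)) \<and>
    (\<forall>u\<in>verts G. \<forall>v\<in>verts G. u \<noteq> v \<and> {u, v} \<notin> edges G \<longrightarrow> (\<exists>S. linked k G u v S))"
  (is "_ \<longleftrightarrow> _ \<and> _ \<and> ?sparse \<and> ?linked")
proof (cases "simple_graph G \<and> k + 1 \<le> card (verts G)")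
  case True
  then have simple: "simple_graph G" and ne: "verts G \<noteq> {}" and pos: "0 < k + 1" by auto
  have le: "\<not> k + 1 \<le> a \<longleftrightarrow> a \<le> k" for a :: nat by auto
  have "\<not> k + 1 \<le> strength G \<longleftrightarrow> (\<forall>S. S \<subseteq> verts G \<and> 2 \<le> card S \<longrightarrow>
      (\<exists>T. T \<subset> S \<and> T \<noteq> {} \<and> \<not> k + 1 \<le> card (crossing G S T)))"
    unfolding le_strength_iff[OF simple ne pos] by (simp only: not_ex not_all de_Morgan_conj de_Morgan_disj not_not not_imp imp_conv_disj disj_assoc conj_assoc)
  then have "strength G \<le> k \<longleftrightarrow> ?sparse" unfolding le .
  then have "edge_maximal k G \<longleftrightarrow> ?sparse \<and>
      (\<forall>u\<in>verts G. \<forall>v\<in>verts G. u \<noteq> v \<and> {u, v} \<notin> edges G \<longrightarrow> k + 1 \<le> strength (add_edge G {u, v}))"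
    using True unfolding edge_maximal_def by simp
  also have "\<dots> \<longleftrightarrow> ?sparse \<and> ?linked"
    using le_strength_add_edge_iff[OF simple] \<open>strength G \<le> k \<longleftrightarrow> ?sparse\<close>
    by (intro conj_cong ball_cong imp_cong) (assumption | rule refl | blast)+
  finally show ?thesis using True by simp
next
  case False
  then show ?thesis unfolding edge_maximal_def by blast
qed

lemma edge_maximal_simple: "edge_maximal k G \<Longrightarrow> simple_graph G"
  and edge_maximal_finite: "edge_maximal k G \<Longrightarrow> finite (verts G)"
  and edge_maximal_card: "edge_maximal k G \<Longrightarrow> k + 1 \<le> card (verts G)"
  by (auto simp: edge_maximal_def simple_graph_def)

lemma edge_maximal_linked:
  assumes "edge_maximal k G" "u \<in> verts G" "v \<in> verts G" "u \<noteq> v" "{u, v} \<notin> edges G"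
  obtains S where "linked k G u v S"
  using assms unfolding edge_maximal_iff by blast

lemma edge_maximal_sparse:
  assumes "edge_maximal k G" "S \<subseteq> verts G" "2 \<le> card S"
  obtains T where "T \<subset> S" "T \<noteq> {}" "card (crossing G S T) \<le> k"
  using assms unfolding edge_maximal_iff by blast

section \<open>Small cuts in edge-maximal graphs\<close>

text \<open>The ends in \<open>A\<close> of the edges leaving \<open>A\<close>; for an edge-join these are the attachment vertices of one
  side.\<close>

definition attach :: "'a graph \<Rightarrow> 'a set \<Rightarrow> 'a set" where
  "attach G A = {x \<in> A. \<exists>y \<in> verts G - A. {x, y} \<in> edges G}"

lemma crossing_verts_pair:
  assumes "simple_graph G" "e \<in> crossing G (verts G) A"
  obtains x y where "e = {x, y}" "x \<in> attach G A" "x \<in> A" "y \<in> verts G - A"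
proof -
  obtain x y where xy: "e = {x, y}" "x \<in> A" "y \<notin> A" "y \<in> verts G"
    using crossing_endpoints[OF assms] by metis
  moreover have "{x, y} \<in> edges G" using assms(2) xy(1) by (simp add: crossing_def)
  ultimately show thesis using that[of x y] unfolding attach_def by blast
qed

text \<open>A complete bipartite graph between the two sides would have \<open>|A| |V - A| \<ge> |V| - 1\<close> edges.\<close>

lemma exists_nonadjacent_across:
  assumes "simple_graph G" "A \<subset> verts G" "A \<noteq> {}"
    and "card (crossing G (verts G) A) + 2 \<le> card (verts G)"
  obtains u v where "u \<in> A" "v \<in> verts G - A" "{u, v} \<notin> edges G"
proof -
  have fin: "finite (verts G)" using assms(1) by (simp add: simple_graph_def)
  then have finA: "finite A" "finite (verts G - A)"
    using assms(2) by (auto intro: finite_subset)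
  let ?pairs = "(\<lambda>(x, y). {x, y}) ` (A \<times> (verts G - A))"
  have "\<exists>u\<in>A. \<exists>v\<in>verts G - A. {u, v} \<notin> edges G"
  proof (rule ccontr)
    assume "\<not> ?thesis"
    then have "?pairs \<subseteq> crossing G (verts G) A"
      using assms(2) by (force simp: crossing_def)
    then have "card ?pairs \<le> card (crossing G (verts G) A)"
      using finite_crossing[OF assms(1)] by (rule card_mono[rotated])
    moreover have "inj_on (\<lambda>(x, y). {x, y}) (A \<times> (verts G - A))"
      by (auto simp: inj_on_def doubleton_eq_iff)
    then have "card ?pairs = card A * card (verts G - A)"
      by (simp add: card_image card_cartesian_product)
    moreover have "card (verts G) = card A + card (verts G - A)"
      using assms(2) finA fin by (simp add: card_Diff_subset card_mono psubset_imp_subset)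
    moreover have "card A > 0" "card (verts G - A) > 0"
      using assms(2,3) finA by (auto simp: card_gt_0_iff)
    then obtain a b where "card A = Suc a" "card (verts G - A) = Suc b"
      using gr0_implies_Suc by metis
    ultimately show False using assms(4) by simp
  qed
  then show thesis using that by blast
qed

lemma linked_subset: "linked k G u v S \<Longrightarrow> S \<subseteq> verts G"
  and linked_endpoints: "linked k G u v S \<Longrightarrow> u \<in> S" "linked k G u v S \<Longrightarrow> v \<in> S"
  and linked_le_crossing: "linked k G u v S \<Longrightarrow> T \<subset> S \<Longrightarrow> T \<noteq> {} \<Longrightarrow>
    k + 1 \<le> card (crossing G S T) + (if u \<in> T \<longleftrightarrow> v \<in> T then 0 else 1)"
  by (simp_all add: linked_def)

text \<open>A cut between \<open>u\<close> and \<open>v\<close> loses at most the one edge \<open>uv\<close>.\<close>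

lemma linked_across_le:
  assumes "simple_graph G" "linked k G u v S" "u \<in> A" "v \<notin> A"
  shows "k \<le> card (crossing G S (S \<inter> A))"
    and "crossing G S (S \<inter> A) \<subseteq> crossing G (verts G) A"
proof -
  have "S \<inter> A \<subset> S" "S \<inter> A \<noteq> {}" using assms by (auto simp: linked_def)
  then have "k + 1 \<le> card (crossing G S (S \<inter> A)) + 1"
    using linked_le_crossing[OF assms(2), of "S \<inter> A"] linked_endpoints[OF assms(2)] assms(3,4) by simp
  then show "k \<le> card (crossing G S (S \<inter> A))" by simp
  show "crossing G S (S \<inter> A) \<subseteq> crossing G (verts G) A"
    using assms(2) unfolding linked_def crossing_def by blast
qed

text \<open>A cut of fewer than \<open>k\<close> edges leaves a non-adjacent pair across it, and a set that links this pair
  needs at least \<open>k\<close> edges of the cut. So \<open>k\<close>-edge-maximal graphs are \<open>k\<close>-edge-connected.\<close>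

lemma edge_maximal_le_crossing:
  assumes "edge_maximal k G" "A \<subset> verts G" "A \<noteq> {}"
  shows "k \<le> card (crossing G (verts G) A)"
proof (rule ccontr)
  have simple: "simple_graph G" using assms(1) by (rule edge_maximal_simple)
  assume small: "\<not> ?thesis"
  then obtain u v where uv: "u \<in> A" "v \<in> verts G - A" "{u, v} \<notin> edges G"
    using exists_nonadjacent_across[OF simple assms(2,3)] edge_maximal_card[OF assms(1)] by auto
  then obtain S where S: "linked k G u v S"
    using edge_maximal_linked[OF assms(1), of u v] assms(2) by blast
  have "v \<notin> A" using uv by simp
  note across = linked_across_le[OF simple S \<open>u \<in> A\<close> this]
  have "k \<le> card (crossing G (verts G) A)"
    using across(1) card_mono[OF finite_crossing[OF simple] across(2)] by simp
  with small show False by simp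
qed

text \<open>If a linking set met both sides, the cut would give it a cut of at most \<open>k\<close> edges that does not
  separate \<open>u\<close> from \<open>v\<close>.\<close>

lemma linked_subset_side:
  assumes "simple_graph G" "linked k G u v S" "u \<in> A" "v \<in> A"
    and "card (crossing G (verts G) A) \<le> k"
  shows "S \<subseteq> A"
proof (rule ccontr)
  assume "\<not> S \<subseteq> A"
  then have "S \<inter> A \<subset> S" "S \<inter> A \<noteq> {}" using assms by (auto simp: linked_def)
  then have "k + 1 \<le> card (crossing G S (S \<inter> A))"
    using linked_le_crossing[OF assms(2), of "S \<inter> A"] linked_endpoints[OF assms(2)] assms(3,4) by simp
  also have "\<dots> \<le> card (crossing G (verts G) A)"
    using assms(2) finite_crossing[OF assms(1)]
    by (intro card_mono) (auto simp: linked_def crossing_def)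
  finally show False using assms(5) by simp
qed

text \<open>A cut of at most \<open>k\<close> edges between \<open>u\<close> and \<open>v\<close> cannot spare any of its edges, so all of them lie
  inside the linking set.\<close>

lemma linked_contains_small_cut:
  assumes "simple_graph G" "linked k G u v S" "u \<in> A" "v \<notin> A"
    and "card (crossing G (verts G) A) \<le> k"
  shows "crossing G (verts G) A = crossing G S (S \<inter> A)"
  using linked_across_le[OF assms(1-4)] assms(5)
  by (intro card_seteq[symmetric] finite_crossing[OF assms(1)]) simp_all

lemma attach_subset_linked:
  assumes "simple_graph G" "linked k G u v S" "A \<subseteq> verts G" "u \<in> A" "v \<notin> A"
    and "card (crossing G (verts G) A) \<le> k"
  shows "attach G A \<subseteq> S \<inter> A"
proof
  fix x assume "x \<in> attach G A"
  then obtain y where y: "x \<in> A" "y \<in> verts G - A" "{x, y} \<in> edges G" by (auto simp: attach_def)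
  then have "{x, y} \<in> crossing G (verts G) A" using assms(3) by (auto simp: crossing_def)
  then have "{x, y} \<in> crossing G S (S \<inter> A)"
    unfolding linked_contains_small_cut[OF assms(1,2,4,5,6)] .
  then show "x \<in> S \<inter> A" using y by (simp add: crossing_def)
qed

text \<open>Degree count on \<open>S \<inter> A\<close>, of size \<open>a\<close> say. A vertex of \<open>S \<inter> A\<close> has at most \<open>a - 1\<close> neighbours in
  \<open>S \<inter> A\<close> but degree at least \<open>k + 1\<close> in \<open>G[S]\<close>, or \<open>k\<close> in the case of \<open>u\<close>. Hence it is an end of at
  least \<open>k + 2 - a\<close> cut edges, or \<open>k + 1 - a\<close> in the case of \<open>u\<close>. Since there are at most \<open>k\<close> cut
  edges, \<open>(a - 1) (k + 2 - a) + (k + 1 - a) \<le> k\<close>, that is \<open>(a - 1) (k + 1 - a) \<le> 0\<close>, if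
  \<open>a \<le> k + 1\<close>. In the extremal case \<open>a = k + 1\<close> the \<open>k\<close> vertices other than \<open>u\<close> use up all cut edges.\<close>

lemma linked_side_card:
  assumes simple: "simple_graph G" and S: "linked k G u v S"
    and A: "A \<subseteq> verts G" "u \<in> A" "v \<notin> A" and cut: "card (crossing G (verts G) A) \<le> k"
  shows "card (S \<inter> A) = 1 \<or> k + 2 \<le> card (S \<inter> A) \<or>
    (card (S \<inter> A) = k + 1 \<and> attach G A = S \<inter> A - {u})"
proof -
  let ?F = "crossing G (verts G) A" and ?S = "S \<inter> A"
  \<comment> \<open>\<open>f y\<close> is the number of cut edges at \<open>y\<close>.\<close>
  define f where "f y = card {e \<in> ?F. y \<in> e}" for y
  have "finite (verts G)" using simple by (simp add: simple_graph_def)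
  then have finS: "finite ?S" using A(1) by (meson finite_Int finite_subset)
  have finF: "finite ?F" using simple by (rule finite_crossing)
  have u: "u \<in> ?S" "v \<in> S" using S A(2) by (auto simp: linked_def)
  have deg: "k + 1 \<le> f y + (card ?S - 1) + (if y = u then 1 else 0)" if y: "y \<in> ?S" for y
  proof -
    have "y \<noteq> v" "{y} \<subset> S" using y u A(3) by auto
    then have low: "k + 1 \<le> card (crossing G S {y}) + (if y = u then 1 else 0)"
      using linked_le_crossing[OF S, of "{y}"] by auto
    have "crossing G S {y} \<subseteq> {e \<in> ?F. y \<in> e} \<union> (\<lambda>z. {y, z}) ` (?S - {y})"
    proof
      fix e assume e: "e \<in> crossing G S {y}"
      then obtain a z where az: "e = {a, z}" "a \<in> {y}" "z \<notin> {y}" "z \<in> S"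
        using crossing_endpoints[OF simple] by metis
      then have z: "e = {y, z}" "z \<noteq> y" "z \<in> S" by auto
      have "e \<in> edges G" using e by (simp add: crossing_def)
      moreover have "S \<subseteq> verts G" using S by (simp add: linked_def)
      ultimately show "e \<in> {e \<in> ?F. y \<in> e} \<union> (\<lambda>z. {y, z}) ` (?S - {y})"
        using z y by (cases "z \<in> A") (auto simp: crossing_def)
    qed
    then have "card (crossing G S {y}) \<le> card ({e \<in> ?F. y \<in> e} \<union> (\<lambda>z. {y, z}) ` (?S - {y}))"
      using finF finS by (intro card_mono) auto
    also have "\<dots> \<le> f y + card (?S - {y})"
      unfolding f_def using card_image_le[of "?S - {y}" "\<lambda>z. {y, z}"] finS
      by (intro order_trans[OF card_Un_le]) simp
    finally have "card (crossing G S {y}) \<le> f y + (card ?S - 1)"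
      using y by (simp only: card_Diff_singleton)
    with low show ?thesis by linarith
  qed
  have pos: "card ?S > 0" using u finS by (auto simp: card_gt_0_iff)
  have "sum f ?S \<le> k"
  proof -
    \<comment> \<open>A cut edge has only one end in \<open>A\<close>, so no cut edge is counted twice.\<close>
    have "{e \<in> ?F. y \<in> e} \<inter> {e \<in> ?F. z \<in> e} = {}" if yz: "y \<in> ?S" "z \<in> ?S" "y \<noteq> z" for y z
    proof (rule ccontr)
      assume "\<not> ?thesis"
      then obtain e where e: "e \<in> ?F" "y \<in> e" "z \<in> e" by blast
      obtain a b where "e = {a, b}" "a \<in> A" "b \<notin> A" using crossing_endpoints[OF simple e(1)] by metis
      with e yz show False by auto
    qed
    then have "sum f ?S = card (\<Union>y\<in>?S. {e \<in> ?F. y \<in> e})"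
      unfolding f_def using finS finF by (intro card_UN_disjoint[symmetric]) auto
    also have "\<dots> \<le> card ?F" using finF by (intro card_mono) auto
    finally show ?thesis using cut by simp
  qed
  moreover have "sum f ?S = f u + sum f (?S - {u})" using u finS by (simp add: sum.remove)
  moreover have "card (?S - {u}) * (k + 2 - card ?S) \<le> sum f (?S - {u})"
  proof -
    have "k + 2 - card ?S \<le> f y" if "y \<in> ?S - {u}" for y using deg[of y] that pos by auto
    then show ?thesis using sum_bounded_below[of "?S - {u}" "k + 2 - card ?S" f] by simp
  qed
  moreover have "card (?S - {u}) = card ?S - 1" using u finS by (simp add: card_Diff_singleton)
  ultimately have total: "f u + (card ?S - 1) * (k + 2 - card ?S) \<le> k" by simp
  have du: "k + 1 \<le> f u + card ?S" using deg[OF u(1)] card_gt_0_iff[of ?S] u finS by auto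
  show ?thesis
  proof (rule ccontr)
    assume no: "\<not> ?thesis"
    then have "2 \<le> card ?S" "card ?S \<le> k + 1" using pos by auto
    then obtain j i where j: "card ?S = j + 2" and i: "k + 1 = j + 2 + i"
      by (metis add.commute le_Suc_ex)
    have "i = 0"
    proof (rule ccontr)
      assume "i \<noteq> 0"
      then have "i \<ge> 1" by simp
      have "(j + 1) * (i + 1) + i \<le> j + 1 + i" using total du j i by auto
      then have "j * i + i \<le> 0" by (simp add: algebra_simps)
      with \<open>i \<ge> 1\<close> show False by simp
    qed
    then have card: "card ?S = k + 1" and k: "k = j + 1" using i j by auto
    then have "f u = 0" using total by simp
    have "attach G A = ?S - {u}"
    proof
      have "u \<notin> attach G A"
      proof
        assume "u \<in> attach G A"
        then obtain y where "y \<in> verts G - A" "{u, y} \<in> edges G" by (auto simp: attach_def)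
        then have "{u, y} \<in> {e \<in> ?F. u \<in> e}" using A by (auto simp: crossing_def)
        then show False using \<open>f u = 0\<close> finF by (auto simp: f_def)
      qed
      then show "attach G A \<subseteq> ?S - {u}" using attach_subset_linked[OF simple S A cut] by blast
    next
      show "?S - {u} \<subseteq> attach G A"
      proof
        fix y assume y: "y \<in> ?S - {u}"
        then have "f y \<noteq> 0" using deg[of y] card by auto
        then obtain e where e: "e \<in> ?F" "y \<in> e" unfolding f_def by (metis (no_types, lifting) card.empty empty_Collect_eq)
        obtain a b where "e = {a, b}" "a \<in> attach G A" "b \<in> verts G - A"
          using crossing_verts_pair[OF simple e(1)] by metis
        then show "y \<in> attach G A" using e y by auto
      qed
    qed
    with no card show False by simp
  qed
qed

lemma attach_nonempty:
  assumes "edge_maximal k G" "0 < k" "A \<subset> verts G" "A \<noteq> {}"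
  shows "attach G A \<noteq> {}"
proof -
  have "card (crossing G (verts G) A) \<noteq> 0" using edge_maximal_le_crossing[OF assms(1,3,4)] assms(2) by simp
  then obtain e where "e \<in> crossing G (verts G) A" by (metis card.empty ex_in_conv)
  then show ?thesis using crossing_verts_pair[OF edge_maximal_simple[OF assms(1)]] by (metis empty_iff)
qed

text \<open>There are non-adjacent \<open>u \<in> A\<close> and \<open>v \<notin> A\<close> such that the cut edges do not all end in \<open>u\<close>: take \<open>u\<close>
  without cut edges if possible, and otherwise all vertices of \<open>A\<close>, at least two, are ends of cut
  edges. The set linking \<open>u\<close> and \<open>v\<close> contains these ends, so its trace on \<open>A\<close> has more than one vertex
  and the degree count applies.\<close>

lemma edge_maximal_side_card:
  assumes G: "edge_maximal k G" and "0 < k" "k + 2 \<le> card (verts G)"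
    and A: "A \<subset> verts G" "2 \<le> card A" and cut: "card (crossing G (verts G) A) \<le> k"
  shows "k + 1 \<le> card A"
proof -
  have simple: "simple_graph G" using G by (rule edge_maximal_simple)
  have "A \<noteq> {}" using A(2) by auto
  have "\<exists>u\<in>A. \<exists>v\<in>verts G - A. {u, v} \<notin> edges G \<and> attach G A \<noteq> {u}"
  proof (cases "attach G A = A")
    case True
    moreover have "A \<noteq> {u}" for u using A(2) by auto
    ultimately show ?thesis
      using exists_nonadjacent_across[OF simple A(1) \<open>A \<noteq> {}\<close>] cut assms(3)
      by (metis add_le_mono1 le_trans)
  next
    case False
    then obtain u where u: "u \<in> A" "u \<notin> attach G A" by (auto simp: attach_def)
    obtain v where v: "v \<in> verts G - A" using A(1) by blast
    have "{u, v} \<notin> edges G" using u v by (auto simp: attach_def)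
    with u v show ?thesis by blast
  qed
  then obtain u v where uv: "u \<in> A" "v \<in> verts G" "v \<notin> A" "{u, v} \<notin> edges G" "attach G A \<noteq> {u}"
    by blast
  then obtain S where S: "linked k G u v S"
    using edge_maximal_linked[OF G, of u v] A(1) by blast
  have "attach G A \<subseteq> S \<inter> A"
    using attach_subset_linked[OF simple S _ uv(1,3) cut] A(1) by blast
  moreover have "u \<in> S \<inter> A" using S uv by (simp add: linked_def)
  ultimately have "card (S \<inter> A) \<noteq> 1"
    using attach_nonempty[OF G assms(2) A(1) \<open>A \<noteq> {}\<close>] uv(5)
    by (metis One_nat_def card_1_singleton_iff singletonD subset_singletonD)
  then have "k + 1 \<le> card (S \<inter> A)"
    using linked_side_card[OF simple S _ uv(1,3) cut] A(1) by auto
  also have "\<dots> \<le> card A"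
    using A(1) edge_maximal_finite[OF G] by (intro card_mono) (auto intro: finite_subset)
  finally show ?thesis .
qed

lemma linked_induced:
  assumes "S \<subseteq> A" "A \<subseteq> verts G"
  shows "linked k (induced_subgraph G A) u v S \<longleftrightarrow> linked k G u v S"
  using assms unfolding linked_def by (auto simp: crossing_induced)

lemma edge_maximal_side:
  assumes G: "edge_maximal k G" and "0 < k" "k + 2 \<le> card (verts G)"
    and A: "A \<subset> verts G" "2 \<le> card A" and cut: "card (crossing G (verts G) A) \<le> k"
  shows "edge_maximal k (induced_subgraph G A)"
proof -
  have simple: "simple_graph G" using G by (rule edge_maximal_simple)
  have "\<exists>T. T \<subset> S \<and> T \<noteq> {} \<and> card (crossing (induced_subgraph G A) S T) \<le> k"
    if "S \<subseteq> A" "2 \<le> card S" for S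
    using edge_maximal_sparse[OF G _ that(2)] that(1) A(1)
    unfolding crossing_induced[OF that(1)] by (metis psubset_imp_subset subset_trans)
  moreover have "\<exists>S. linked k (induced_subgraph G A) u v S"
    if uv: "u \<in> A" "v \<in> A" "u \<noteq> v" "{u, v} \<notin> edges (induced_subgraph G A)" for u v
  proof -
    have "{u, v} \<notin> edges G" using uv by (simp add: induced_subgraph_def)
    then obtain S where S: "linked k G u v S"
      using edge_maximal_linked[OF G, of u v] A(1) uv by blast
    then have "S \<subseteq> A" using linked_subset_side[OF simple S] uv cut by blast
    then have "linked k (induced_subgraph G A) u v S"
      using S linked_induced psubset_imp_subset[OF A(1)] by metis
    then show ?thesis ..
  qed
  moreover have "simple_graph (induced_subgraph G A)"
    using simple_graph_induced[OF simple] A(1) by blast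
  ultimately show ?thesis
    using edge_maximal_side_card[OF assms] unfolding edge_maximal_iff verts_induced by blast
qed

section \<open>Kernels\<close>

lemma edge_maximal_connected:
  assumes "edge_maximal k G" "0 < k"
  shows "connected_graph G"
proof -
  have "verts G \<noteq> {}" using edge_maximal_card[OF assms(1)] by auto
  moreover have "crossing G (verts G) T \<noteq> {}" if "T \<subset> verts G" "T \<noteq> {}" for T
    using edge_maximal_le_crossing[OF assms(1) that] assms(2) by auto
  ultimately show ?thesis
    using connected_graph_iff_crossing[OF edge_maximal_simple[OF assms(1)]] by blast
qed

lemma conn_rel_stays:
  assumes "simple_graph G" "(x, y) \<in> conn_rel G" "x \<in> A" "crossing G (verts G) A = {}"
  shows "y \<in> A"
proof -
  have "(x, y) \<in> {(x, y). {x, y} \<in> edges G}\<^sup>*" using assms(2) by (simp add: conn_rel_def)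
  then show ?thesis
  proof induction
    case (step y z)
    then have "{y, z} \<in> edges G" by simp
    then have "y \<in> verts G" "z \<in> verts G" using assms(1) unfolding simple_graph_def by auto
    then show ?case
      using \<open>{y, z} \<in> edges G\<close> step.IH assms(4) crossing_pairI[of y z G "verts G" A] by blast
  qed (fact assms(3))
qed

lemma crossing_component_empty:
  assumes "simple_graph G" "A \<in> verts G // conn_rel G"
  shows "crossing G (verts G) A = {}"
proof (rule ccontr)
  assume "\<not> ?thesis"
  then obtain e where e: "e \<in> crossing G (verts G) A" by blast
  then obtain x y where xy: "e = {x, y}" "x \<in> A" "y \<notin> A" "x \<in> verts G" "y \<in> verts G"
    using crossing_endpoints[OF assms(1)] by metis
  moreover have "e \<in> edges G" using e by (simp add: crossing_def)
  ultimately have "(x, y) \<in> conn_rel G" by (simp add: conn_rel_def r_into_rtrancl)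
  then show False using in_quotient_imp_closed[OF equiv_conn_rel assms(2) xy(2)] xy(3) by blast
qed

lemma crossing_delete_edges: "crossing (delete_edges G X) S T = crossing G S T - X"
  by (auto simp: crossing_def delete_edges_def)

lemma induced_delete_crossing:
  "induced_subgraph (delete_edges G (crossing G S A)) A = induced_subgraph G A"
  by (auto simp: induced_subgraph_def delete_edges_def crossing_def)

lemma verts_delete_edges [simp]: "verts (delete_edges G X) = verts G"
  by (simp add: delete_edges_def)

text \<open>The deleted \<open>k\<close> edges contain all edges leaving the component \<open>A\<close>; these are already at least \<open>k\<close>, so
  there is equality and no edge inside \<open>A\<close> gets lost. In particular the component is an induced subgraph
  of \<open>G\<close>.\<close>

lemma kernel_stepE:
  assumes G: "edge_maximal k G" and "0 < k" and step: "kernel_step k G G'"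
  obtains A where "A \<subset> verts G" "A \<noteq> {}" "card (crossing G (verts G) A) = k"
    "G' = induced_subgraph G A"
proof -
  have simple: "simple_graph G" using G by (rule edge_maximal_simple)
  have con: "connected_graph G" using G \<open>0 < k\<close> by (rule edge_maximal_connected)
  from step obtain X where X: "edge_cut G X" "card X = k" "G' \<in> graph_components (delete_edges G X)"
    unfolding kernel_step_def by blast
  let ?D = "delete_edges G X"
  obtain A where A: "A \<in> verts G // conn_rel ?D" "G' = induced_subgraph ?D A"
    using X(3) unfolding graph_components_def verts_delete_edges by blast
  have simpleD: "simple_graph ?D" using simple by (rule simple_graph_delete_edges)
  have ne: "A \<noteq> {}" "A \<subseteq> verts G"
    using in_quotient_imp_non_empty[OF equiv_conn_rel[of ?D]]
      in_quotient_imp_subset[OF equiv_conn_rel[of ?D]] A(1) by auto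
  obtain T where T: "T \<subset> verts G" "T \<noteq> {}" "crossing G (verts G) T \<subseteq> X"
    and finX: "finite X"
    using X(1) simple_graph_finite_edges[OF simple] finite_subset
    unfolding edge_cut_iff_crossing[OF simple con] by blast
  have "A \<noteq> verts G"
  proof
    assume "A = verts G"
    obtain x y where xy: "x \<in> T" "y \<in> verts G" "y \<notin> T" using T by blast
    then have "(x, y) \<in> conn_rel ?D"
      using in_quotient_imp_in_rel[OF equiv_conn_rel[of ?D]] A(1) \<open>A = verts G\<close> T(1) by auto
    moreover have "crossing ?D (verts ?D) T = {}" using T(3) by (simp add: crossing_delete_edges)
    ultimately show False using conn_rel_stays[OF simpleD] xy by blast
  qed
  then have proper: "A \<subset> verts G" using ne by blast
  have sub: "crossing G (verts G) A \<subseteq> X"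
    using crossing_component_empty[OF simpleD, of A] A(1) by (simp add: crossing_delete_edges)
  have "crossing G (verts G) A = X"
    using edge_maximal_le_crossing[OF G proper ne(1)] X(2) finX sub by (simp add: card_seteq)
  then show thesis
    using that[OF proper ne(1)] X(2) A(2) induced_delete_crossing[of G "verts G" A] by simp
qed

text \<open>No remaining edge leaves \<open>A\<close>, and connectedness of \<open>G[A]\<close> makes \<open>A\<close> one whole component.\<close>

lemma kernel_stepI:
  assumes G: "edge_maximal k G" and "0 < k"
    and A: "A \<subset> verts G" "card (crossing G (verts G) A) = k" and con: "connected_graph (induced_subgraph G A)"
  shows "kernel_step k G (induced_subgraph G A)"
proof -
  have simple: "simple_graph G" using G by (rule edge_maximal_simple)
  let ?X = "crossing G (verts G) A"
  let ?D = "delete_edges G ?X"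
  have ne: "A \<noteq> {}" using con by (simp add: connected_graph_def)
  have "?X \<subseteq> edges G" unfolding crossing_def by blast
  then have cut: "edge_cut G ?X"
    using A(1) ne unfolding edge_cut_iff_crossing[OF simple edge_maximal_connected[OF G \<open>0 < k\<close>]] by blast
  have simpleD: "simple_graph ?D" using simple by (rule simple_graph_delete_edges)
  obtain x where x: "x \<in> A" using ne by blast
  have "conn_rel ?D `` {x} = A"
  proof
    have "crossing ?D (verts ?D) A = {}" by (simp add: crossing_delete_edges)
    then show "conn_rel ?D `` {x} \<subseteq> A" using conn_rel_stays[OF simpleD _ x] by blast
  next
    have "{(x, y). {x, y} \<in> edges (induced_subgraph G A)} \<subseteq> {(x, y). {x, y} \<in> edges ?D}"
      by (auto simp: induced_subgraph_def delete_edges_def crossing_def)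
    then have mono: "{(x, y). {x, y} \<in> edges (induced_subgraph G A)}\<^sup>* \<subseteq> {(x, y). {x, y} \<in> edges ?D}\<^sup>*"
      by (rule rtrancl_mono)
    show "A \<subseteq> conn_rel ?D `` {x}"
    proof
      fix y assume "y \<in> A"
      then have "(x, y) \<in> {(x, y). {x, y} \<in> edges (induced_subgraph G A)}\<^sup>*"
        using con x by (simp add: connected_graph_def conn_rel_def)
      then show "y \<in> conn_rel ?D `` {x}"
        using mono x \<open>y \<in> A\<close> A(1) by (auto simp: conn_rel_def)
    qed
  qed
  then have "A \<in> verts ?D // conn_rel ?D" using x A(1) by (metis psubsetD quotientI verts_delete_edges)
  then have "induced_subgraph ?D A \<in> graph_components ?D" unfolding graph_components_def by (rule imageI)
  then show ?thesis using cut A(2) unfolding kernel_step_def induced_delete_crossing by blast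
qed

lemma kernel_step_verts: "kernel_step k G G' \<Longrightarrow> verts G' \<subseteq> verts G"
  using in_quotient_imp_subset[OF equiv_conn_rel]
  unfolding kernel_step_def graph_components_def by fastforce

text \<open>The definition of a kernel does not ask the intermediate graphs to be edge-maximal. They are:
  vertex sets shrink along the sequence, and the last graph has at least \<open>k + 1\<close> vertices, so every
  earlier graph has at least \<open>k + 2\<close> and the side of its cut that is kept is not a single vertex. The
  rule transports a property along the sequence with this knowledge.\<close>

lemma kernel_chain_induct [consumes 2, case_names whole side]:
  assumes Q: "is_kernel k Q G" and "0 < k"
    and whole: "P G"
    and side: "\<And>H A. edge_maximal k H \<Longrightarrow> P H \<Longrightarrow> A \<subset> verts H \<Longrightarrow>
      card (crossing H (verts H) A) = k \<Longrightarrow> verts Q \<subseteq> A \<Longrightarrow> P (induced_subgraph H A)"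
  shows "P Q"
proof -
  have Qmax: "edge_maximal k Q" using Q by (simp add: is_kernel_def)
  have "(kernel_step k)\<^sup>*\<^sup>* G Q" using Q by (simp add: is_kernel_def)
  then have "verts Q \<subseteq> verts G \<and> (edge_maximal k G \<longrightarrow> P G \<longrightarrow> P Q)"
  proof (induction rule: converse_rtranclp_induct)
    case (step H H')
    have "P Q" if H: "edge_maximal k H" "P H"
    proof -
      obtain A where A: "A \<subset> verts H" "A \<noteq> {}" "card (crossing H (verts H) A) = k"
        "H' = induced_subgraph H A"
        using kernel_stepE[OF H(1) \<open>0 < k\<close> step.hyps(1)] by blast
      have QA: "verts Q \<subseteq> A" using step.IH A(4) by simp
      have finH: "finite (verts H)" using H(1) by (rule edge_maximal_finite)
      then have "finite A" using A(1) by (meson finite_subset psubset_imp_subset)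
      then have "k + 1 \<le> card A" using edge_maximal_card[OF Qmax] QA card_mono le_trans by blast
      moreover have "card A < card (verts H)" using A(1) finH by (rule psubset_card_mono[rotated])
      ultimately have "edge_maximal k H'"
        using edge_maximal_side[OF H(1) \<open>0 < k\<close> _ A(1)] A(3,4) \<open>0 < k\<close> by simp
      then show ?thesis using step.IH side[OF H A(1,3) QA] A(4) by blast
    qed
    then show ?case using step.IH kernel_step_verts[OF step.hyps(1)] by blast
  qed simp
  then show ?thesis using Q whole by (simp add: is_kernel_def)
qed

lemma induced_induced: "A \<subseteq> U \<Longrightarrow> induced_subgraph (induced_subgraph G U) A = induced_subgraph G A"
  by (auto simp: induced_subgraph_def)

lemma induced_verts: "simple_graph G \<Longrightarrow> induced_subgraph G (verts G) = G"
  by (cases G) (auto simp: induced_subgraph_def simple_graph_def)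

lemma kernel_verts: "is_kernel k Q G \<Longrightarrow> verts Q \<subseteq> verts G"
  by (simp add: is_kernel_def subgraph_def)

lemma kernel_is_induced:
  assumes "is_kernel k Q G" "0 < k"
  shows "Q = induced_subgraph G (verts Q)"
  using assms
proof (induction rule: kernel_chain_induct)
  case whole
  have "simple_graph G" using assms(1) by (simp add: is_kernel_def edge_maximal_def)
  then show ?case by (simp add: induced_verts)
next
  case (side H A)
  then show ?case by (metis induced_induced psubset_imp_subset verts_induced)
qed

lemma crossing_kernel:
  assumes "is_kernel k Q G" "0 < k" "S \<subseteq> verts Q"
  shows "crossing Q S T = crossing G S T"
  using kernel_is_induced[OF assms(1,2)] crossing_induced[OF assms(3)] by metis

lemma is_kernel_refl: "edge_maximal k G \<Longrightarrow> is_kernel k G G"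
  by (simp add: is_kernel_def subgraph_def edge_maximal_def)

lemma is_kernel_side:
  assumes P: "is_kernel k P G" and "0 < k" "k + 2 \<le> card (verts P)"
    and A: "A \<subset> verts P" "2 \<le> card A" "card (crossing P (verts P) A) = k"
  shows "is_kernel k (induced_subgraph P A) G"
proof -
  have Pmax: "edge_maximal k P" using P by (simp add: is_kernel_def)
  have max: "edge_maximal k (induced_subgraph P A)"
    using edge_maximal_side[OF Pmax assms(2,3) A(1,2)] A(3) by simp
  then have "kernel_step k P (induced_subgraph P A)"
    using kernel_stepI[OF Pmax \<open>0 < k\<close> A(1,3)] edge_maximal_connected \<open>0 < k\<close> by blast
  moreover have "subgraph (induced_subgraph P A) G"
    using P edge_maximal_simple[OF max] A(1)
    unfolding is_kernel_def subgraph_def by (auto simp: induced_subgraph_def)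
  ultimately show ?thesis
    using P max unfolding is_kernel_def by (meson rtranclp.rtrancl_into_rtrancl)
qed

text \<open>Suppose that \<open>S\<close> reaches across one of the \<open>k\<close>-edge-cuts on the way to \<open>Q\<close>. The part of \<open>S\<close> that
  is cut off there is disjoint from \<open>Q\<close>, hence from \<open>W\<close>, and at most \<open>k\<close> edges of \<open>G[S]\<close> leave it.\<close>

lemma subset_kernel:
  assumes "is_kernel k Q G" "0 < k"
    and "S \<subseteq> verts G" "W \<subseteq> S" "W \<subseteq> verts Q" "W \<noteq> {}"
    and tight: "\<And>T. T \<subset> S \<Longrightarrow> T \<noteq> {} \<Longrightarrow> T \<inter> W = {} \<Longrightarrow> k + 1 \<le> card (crossing G S T)"
  shows "S \<subseteq> verts Q"
proof -
  have "S \<subseteq> verts Q \<and> (\<exists>U. Q = induced_subgraph G U)"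
    using assms(1,2)
  proof (induction rule: kernel_chain_induct)
    case whole
    have "simple_graph G" using assms(1) by (simp add: is_kernel_def edge_maximal_def)
    then show ?case using assms(3) induced_verts by metis
  next
    case (side H A)
    then obtain U where U: "H = induced_subgraph G U" "S \<subseteq> U"
      by (metis verts_induced)
    have "S \<subseteq> A"
    proof (rule ccontr)
      assume "\<not> S \<subseteq> A"
      then have "S - (S \<inter> A) \<noteq> {}" by blast
      moreover have WA: "W \<subseteq> S \<inter> A" using assms(4,5) \<open>verts Q \<subseteq> A\<close> by blast
      then have "S - (S \<inter> A) \<subset> S" using assms(6) by blast
      moreover have "(S - (S \<inter> A)) \<inter> W = {}" using WA by blast
      ultimately have "k + 1 \<le> card (crossing G S (S - (S \<inter> A)))" by - (rule tight)
      also have "\<dots> = card (crossing H S (S \<inter> A))"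
        unfolding U(1) crossing_induced[OF U(2)] by (simp add: crossing_complement)
      also have "\<dots> \<le> card (crossing H (verts H) A)"
        using U finite_crossing[OF edge_maximal_simple[OF \<open>edge_maximal k H\<close>]]
        by (intro card_mono) (auto simp: crossing_def)
      finally show False using \<open>card (crossing H (verts H) A) = k\<close> by simp
    qed
    moreover have "induced_subgraph H A = induced_subgraph G A"
      using U(1) \<open>A \<subset> verts H\<close> by (simp add: induced_induced psubset_imp_subset)
    ultimately show ?case by (metis verts_induced)
  qed
  then show ?thesis ..
qed

text \<open>If \<open>T\<close> contains no end of a cut edge then all edges of \<open>G[S]\<close> leaving \<open>T\<close> stay in \<open>A\<close>.\<close>

lemma linked_side_crossing:
  assumes "simple_graph G" "linked k G u v S" "A \<subseteq> verts G" "u \<in> A" "v \<notin> A"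
    and T: "T \<subseteq> S \<inter> A" "T \<noteq> {}" "T \<inter> attach G A = {}"
  shows "k + 1 \<le> card (crossing G (S \<inter> A) T) + (if u \<in> T then 1 else 0)"
proof -
  have v: "v \<in> S" "v \<notin> T" using linked_endpoints[OF assms(2)] T(1) assms(5) by auto
  then have "T \<subset> S" using T(1) by blast
  then have "k + 1 \<le> card (crossing G S T) + (if u \<in> T then 1 else 0)"
    using linked_le_crossing[OF assms(2) _ T(2)] v by (cases "u \<in> T") auto
  moreover have "crossing G S T \<subseteq> crossing G (S \<inter> A) T"
  proof
    fix e assume e: "e \<in> crossing G S T"
    then obtain x y where xy: "e = {x, y}" "x \<in> T" "y \<notin> T" "x \<in> S" "y \<in> S"
      using crossing_endpoints[OF assms(1)] by metis
    have "{x, y} \<in> edges G" using e xy(1) by (simp add: crossing_def)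
    moreover have "x \<notin> attach G A" "x \<in> A" using T xy(2) by blast+
    moreover have "y \<in> verts G" using xy(5) linked_subset[OF assms(2)] by blast
    ultimately have "y \<in> A" unfolding attach_def by blast
    then show "e \<in> crossing G (S \<inter> A) T"
      using xy \<open>x \<in> A\<close> \<open>{x, y} \<in> edges G\<close> by (simp add: crossing_def)
  qed
  then have "card (crossing G S T) \<le> card (crossing G (S \<inter> A) T)"
    using finite_crossing[OF assms(1)] by (rule card_mono[rotated])
  ultimately show ?thesis by linarith
qed

text \<open>Suppose that \<open>Q\<close> has \<open>k + 1\<close> vertices. For \<open>u \<in> Q\<close> and \<open>v \<notin> A\<close> non-adjacent, the trace on \<open>A\<close> of a
  linking set lies inside \<open>Q\<close>, so the degree count leaves two possibilities: all cut edges end in \<open>u\<close>,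
  or none does and they have exactly \<open>k\<close> ends in \<open>A\<close>. If the ends in \<open>A\<close> are a single vertex then
  another \<open>u \<in> Q\<close> violates both since \<open>k \<ge> 2\<close>; if there are several ends then each of them, as \<open>u\<close>,
  violates both.\<close>

lemma kernel_at_attach_card:
  assumes G: "edge_maximal k G" and k: "2 \<le> k"
    and A: "A \<subset> verts G" "2 \<le> card A" "2 \<le> card (verts G - A)"
    and cut: "card (crossing G (verts G) A) \<le> k"
    and Q: "is_kernel k Q (induced_subgraph G A)" "attach G A \<subseteq> verts Q"
  shows "card (verts Q) \<noteq> k + 1"
proof
  assume cardQ: "card (verts Q) = k + 1"
  have simple: "simple_graph G" using G by (rule edge_maximal_simple)
  have fin: "finite (verts G)" using G by (rule edge_maximal_finite)
  have "0 < k" using k by simp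
  have finA: "finite A" "A \<subseteq> verts G" using A(1) fin by (auto intro: finite_subset)
  have QA: "verts Q \<subseteq> A" using kernel_verts[OF Q(1)] by simp
  have finQ: "finite (verts Q)" using QA finA(1) by (rule finite_subset)
  have "card (verts Q) \<le> card A" using QA finA(1) by (rule card_mono[rotated])
  moreover have "card (verts G) = card A + card (verts G - A)"
    using finA fin by (simp add: card_Diff_subset card_mono)
  ultimately have n: "k + 2 \<le> card (verts G)" using cardQ A(3) by simp
  have "A \<noteq> {}" using A(2) by auto
  have B: "k + 1 \<le> card (verts G - A)"
  proof (rule edge_maximal_side_card[OF G \<open>0 < k\<close> n _ A(3)])
    show "verts G - A \<subset> verts G" using finA(2) \<open>A \<noteq> {}\<close> by blast
    show "card (crossing G (verts G) (verts G - A)) \<le> k"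
      using cut finA(2) by (simp add: crossing_complement)
  qed
  have attach: "attach G A \<noteq> {}" using attach_nonempty[OF G \<open>0 < k\<close> A(1) \<open>A \<noteq> {}\<close>] .
  have key: "attach G A = {u} \<or> (u \<notin> attach G A \<and> card (attach G A) = k)"
    if uv: "u \<in> verts Q" "v \<in> verts G - A" "{u, v} \<notin> edges G" for u v
  proof -
    have uA: "u \<in> A" and vA: "v \<notin> A" using uv QA by auto
    obtain S where S: "linked k G u v S"
      using edge_maximal_linked[OF G, of u v] uv uA finA(2) by blast
    have sub: "attach G A \<subseteq> S \<inter> A" using attach_subset_linked[OF simple S finA(2) uA vA cut] .
    have uS: "u \<in> S \<inter> A" using linked_endpoints(1)[OF S] uA by simp
    have "S \<inter> A \<subseteq> verts Q"
    proof (rule subset_kernel[OF Q(1) \<open>0 < k\<close>])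
      show "S \<inter> A \<subseteq> verts (induced_subgraph G A)" by simp
      show "insert u (attach G A) \<subseteq> S \<inter> A" using sub uS by blast
      show "insert u (attach G A) \<subseteq> verts Q" using Q(2) uv(1) by blast
      show "insert u (attach G A) \<noteq> {}" by blast
      fix T assume T: "T \<subset> S \<inter> A" "T \<noteq> {}" "T \<inter> insert u (attach G A) = {}"
      have "crossing (induced_subgraph G A) (S \<inter> A) T = crossing G (S \<inter> A) T"
        by (rule crossing_induced) simp
      then show "k + 1 \<le> card (crossing (induced_subgraph G A) (S \<inter> A) T)"
        using linked_side_crossing[OF simple S finA(2) uA vA, of T] T by auto
    qed
    then have "card (S \<inter> A) \<le> k + 1" using card_mono[OF finQ] cardQ by metis
    then consider "card (S \<inter> A) = 1" | "card (S \<inter> A) = k + 1" "attach G A = S \<inter> A - {u}"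
      using linked_side_card[OF simple S finA(2) uA vA cut] by force
    then show ?thesis
    proof cases
      case 1
      then have "S \<inter> A = {u}" using uS by (metis One_nat_def card_1_singleton_iff singletonD)
      then show ?thesis using sub attach by (metis subset_singletonD)
    next
      case 2
      then show ?thesis using uS by (simp add: card_Diff_singleton)
    qed
  qed
  obtain x where x: "x \<in> attach G A" using attach by blast
  have xQ: "x \<in> verts Q" using Q(2) x by blast
  show False
  proof (cases "attach G A = {x}")
    case True
    have "verts Q \<noteq> {x}" using cardQ k by auto
    then obtain u where u: "u \<in> verts Q" "u \<noteq> x" using xQ by blast
    obtain v where v: "v \<in> verts G - A" using A(1) by blast
    have "u \<notin> attach G A" using u True by simp
    then have "{u, v} \<notin> edges G" using v u(1) QA unfolding attach_def by blast
    then show False using key[OF u(1) v] True u(2) k by simp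
  next
    case False
    \<comment> \<open>The other side has more than \<open>k\<close> vertices, too many for one vertex to be adjacent to all of them.\<close>
    have "\<exists>v\<in>verts G - A. {x, v} \<notin> edges G"
    proof (rule ccontr)
      assume all: "\<not> ?thesis"
      have "x \<in> A" using x by (simp add: attach_def)
      then have "{x, v} \<in> crossing G (verts G) A" if "v \<in> verts G - A" for v
        using all that finA(2) by (intro crossing_pairI) blast+
      then have "(\<lambda>v. {x, v}) ` (verts G - A) \<subseteq> crossing G (verts G) A" by (rule image_subsetI)
      then have "card ((\<lambda>v. {x, v}) ` (verts G - A)) \<le> k"
        using order_trans[OF card_mono[OF finite_crossing[OF simple]] cut] by simp
      moreover have "inj_on (\<lambda>v. {x, v}) (verts G - A)"
        by (auto simp: inj_on_def doubleton_eq_iff)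
      ultimately show False using B by (simp add: card_image)
    qed
    then obtain v where "v \<in> verts G - A" "{x, v} \<notin> edges G" by blast
    then show False using key[OF xQ] x False by blast
  qed
qed

section \<open>Anchored sets\<close>

text \<open>One half of a linking set. When a second half is glued on along a cut, a subset of \<open>S\<close> that meets \<open>W\<close>
  gains an edge, so that the weaker bound \<open>k\<close> suffices for it.\<close>

definition anchored :: "nat \<Rightarrow> 'a graph \<Rightarrow> 'a set \<Rightarrow> 'a set \<Rightarrow> bool" where
  "anchored k G W S \<longleftrightarrow> S \<subseteq> verts G \<and> W \<subseteq> S \<and>
     (\<forall>T. T \<subset> S \<and> T \<noteq> {} \<longrightarrow>
       k \<le> card (crossing G S T) \<and> (T \<inter> W = {} \<longrightarrow> k + 1 \<le> card (crossing G S T)))"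

lemma anchored_subset: "anchored k G W S \<Longrightarrow> S \<subseteq> verts G"
  and anchored_anchor: "anchored k G W S \<Longrightarrow> W \<subseteq> S"
  and anchored_le_crossing: "anchored k G W S \<Longrightarrow> T \<subset> S \<Longrightarrow> T \<noteq> {} \<Longrightarrow> k \<le> card (crossing G S T)"
  and anchored_less_crossing: "anchored k G W S \<Longrightarrow> T \<subset> S \<Longrightarrow> T \<noteq> {} \<Longrightarrow> T \<inter> W = {} \<Longrightarrow>
    k + 1 \<le> card (crossing G S T)"
  by (simp_all add: anchored_def)

lemma anchored_singleton: "x \<in> verts G \<Longrightarrow> anchored k G {x} {x}"
  unfolding anchored_def by blast

lemma anchored_kernel_transfer:
  assumes "is_kernel k P G" "0 < k" "anchored k P W S"
  shows "anchored k G W S"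
proof -
  have "crossing P S T = crossing G S T" for T
    using crossing_kernel[OF assms(1,2) anchored_subset[OF assms(3)]] .
  then show ?thesis using assms(3) kernel_verts[OF assms(1)] unfolding anchored_def by auto
qed

lemma anchored_induced:
  assumes "anchored k (induced_subgraph G A) W S" "A \<subseteq> verts G"
  shows "anchored k G W S"
proof -
  have S: "S \<subseteq> A" using anchored_subset[OF assms(1)] by simp
  then show ?thesis using assms unfolding anchored_def crossing_induced[OF S] by auto
qed

text \<open>If \<open>T\<close> avoids \<open>W\<close> and is left by exactly \<open>k\<close> edges, then the complement of \<open>T\<close> is the excluded set
  \<open>A\<close>.\<close>

lemma anchored_whole:
  assumes P: "edge_maximal k P" and "W \<subseteq> verts P"
    and no_cut: "\<And>A. A \<subset> verts P \<Longrightarrow> W \<subseteq> A \<Longrightarrow> A \<noteq> {} \<Longrightarrow> card (crossing P (verts P) A) \<noteq> k"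
  shows "anchored k P W (verts P)"
  unfolding anchored_def
proof (intro conjI allI impI)
  fix T assume T: "T \<subset> verts P \<and> T \<noteq> {}"
  then show le: "k \<le> card (crossing P (verts P) T)"
    using edge_maximal_le_crossing[OF P] by blast
  assume "T \<inter> W = {}"
  then have "card (crossing P (verts P) (verts P - T)) \<noteq> k"
    using T assms(2) by (intro no_cut) auto
  then show "k + 1 \<le> card (crossing P (verts P) T)"
    using le T by (simp add: crossing_complement psubset_imp_subset)
qed (use assms in simp_all)

lemma minimal_kernel:
  assumes "is_kernel k P G" "Pr P"
  obtains P' where "is_kernel k P' G" "Pr P'"
    "\<And>Q. is_kernel k Q G \<Longrightarrow> Pr Q \<Longrightarrow> card (verts P') \<le> card (verts Q)"
proof -
  let ?R = "\<lambda>P. is_kernel k P G \<and> Pr P"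
  have "?R P" using assms by simp
  then obtain P' where "?R P'" "\<forall>Q. ?R Q \<longrightarrow> card (verts P') \<le> card (verts Q)"
    using ex_has_least_nat[of ?R P "\<lambda>P. card (verts P)"] by blast
  then show thesis using that by blast
qed

lemma kernel_edge_maximal: "is_kernel k P G \<Longrightarrow> edge_maximal k P"
  by (simp add: is_kernel_def)

text \<open>A smallest kernel containing \<open>W\<close> works: a \<open>k\<close>-edge-cut with \<open>W\<close> on one side would yield a smaller
  kernel containing \<open>W\<close>, because this side has at least \<open>k + 1\<close> vertices.\<close>

lemma anchored_large:
  assumes H: "edge_maximal k H" and "0 < k" and W: "W \<subseteq> verts H" "k + 1 \<le> card W"
  obtains S where "anchored k H W S"
proof -
  obtain P where P: "is_kernel k P H" "W \<subseteq> verts P"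
    and least: "\<And>Q. is_kernel k Q H \<Longrightarrow> W \<subseteq> verts Q \<Longrightarrow> card (verts P) \<le> card (verts Q)"
    using minimal_kernel[OF is_kernel_refl[OF H], of "\<lambda>P. W \<subseteq> verts P"] W(1) by blast
  have Pmax: "edge_maximal k P" using P(1) by (rule kernel_edge_maximal)
  have finP: "finite (verts P)" using Pmax by (rule edge_maximal_finite)
  have "anchored k P W (verts P)"
  proof (rule anchored_whole[OF Pmax P(2)])
    fix A assume A: "A \<subset> verts P" "W \<subseteq> A"
    show "card (crossing P (verts P) A) \<noteq> k"
    proof
      assume cut: "card (crossing P (verts P) A) = k"
      have less: "card A < card (verts P)" using finP A(1) by (rule psubset_card_mono)
      have "finite A" using A(1) finP by (meson finite_subset psubset_imp_subset)
      then have "k + 1 \<le> card A" using card_mono[OF _ A(2)] W(2) by simp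
      then have "is_kernel k (induced_subgraph P A) H"
        using is_kernel_side[OF P(1) \<open>0 < k\<close> _ A(1) _ cut] less \<open>0 < k\<close> by simp
      then show False using least A(2) less by fastforce
    qed
  qed
  then show thesis using that anchored_kernel_transfer[OF P(1) \<open>0 < k\<close>] by blast
qed

text \<open>Let \<open>P\<close> be a smallest kernel that contains the closure \<open>C\<close> and \<open>u\<close>. Unless \<open>P\<close> is anchored, it has a
  \<open>k\<close>-edge-cut with \<open>u\<close> and \<open>W\<close> on one side \<open>A\<close>, and \<open>P[A]\<close> is again a kernel. It cannot contain
  \<open>C\<close>, so the cut also splits \<open>C\<close>, and since \<open>C\<close> is \<open>k\<close>-edge-connected, all \<open>k\<close> cut edges belong to
  \<open>C\<close>. Here \<open>C\<close> having at least \<open>k + 2\<close> vertices matters: \<open>C[A \<inter> C]\<close> is a kernel containing \<open>W\<close> unless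
  \<open>A \<inter> C\<close> is a single vertex \<open>x\<close>, and the former contradicts minimality of the closure. So \<open>W = {x}\<close>
  and all cut edges end in \<open>x\<close>. Now a set linking \<open>u\<close> to a vertex beyond the cut exists in \<open>P\<close>, and its
  trace on \<open>A\<close> is anchored at \<open>u\<close> and \<open>x\<close>.\<close>

lemma anchored_closure:
  assumes C: "is_closure k C (induced_subgraph H W) H" and "0 < k"
    and big: "k + 2 \<le> card (verts C)" and W: "W \<noteq> {}" and u: "u \<in> verts H"
  obtains S where "anchored k H (insert u W) S"
proof -
  have H: "edge_maximal k H" and Ck: "is_kernel k C H"
    and sub: "subgraph (induced_subgraph H W) C"
    and least_closure: "\<And>D. is_kernel k D H \<Longrightarrow> subgraph (induced_subgraph H W) D \<Longrightarrow> subgraph D C \<Longrightarrow> D = C"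
    using C unfolding is_closure_def by blast+
  have WC: "W \<subseteq> verts C" using sub by (simp add: subgraph_def)
  have Cmax: "edge_maximal k C" using Ck by (rule kernel_edge_maximal)
  have finC: "finite (verts C)" using Cmax by (rule edge_maximal_finite)
  show thesis
  proof (cases "insert u W = {u}")
    case True
    \<comment> \<open>A single vertex has no cuts. A kernel would not do here: it might have a \<open>k\<close>-edge-cut around \<open>u\<close> alone.\<close>
    then show thesis using that[of "{u}"] anchored_singleton[OF u] by metis
  next
    case False
    then obtain w where w: "w \<in> W" "w \<noteq> u" by blast
    obtain P where P: "is_kernel k P H" "verts C \<subseteq> verts P \<and> u \<in> verts P"
      and least: "\<And>Q. is_kernel k Q H \<Longrightarrow> verts C \<subseteq> verts Q \<and> u \<in> verts Q \<Longrightarrow> card (verts P) \<le> card (verts Q)"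
      using minimal_kernel[OF is_kernel_refl[OF H], of "\<lambda>P. verts C \<subseteq> verts P \<and> u \<in> verts P"]
        kernel_verts[OF Ck] u by blast
    have Pmax: "edge_maximal k P" using P(1) by (rule kernel_edge_maximal)
    have simpleP: "simple_graph P" using Pmax by (rule edge_maximal_simple)
    have finP: "finite (verts P)" using Pmax by (rule edge_maximal_finite)
    have bigP: "k + 2 \<le> card (verts P)"
      using big P(2) card_mono[OF finP] le_trans by blast
    show thesis
    proof (cases "\<exists>A. A \<subset> verts P \<and> insert u W \<subseteq> A \<and> card (crossing P (verts P) A) = k")
      case False
      then have "anchored k P (insert u W) (verts P)"
        using P(2) WC by (intro anchored_whole[OF Pmax]) blast+
      then show thesis using that anchored_kernel_transfer[OF P(1) \<open>0 < k\<close>] by blast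
    next
      case True
      then obtain A where A: "A \<subset> verts P" "insert u W \<subseteq> A" "card (crossing P (verts P) A) = k"
        by blast
      have finA: "finite A" using A(1) finP by (meson finite_subset psubset_imp_subset)
      have "card {u, w} \<le> card A" using A(2) w finA by (intro card_mono) auto
      then have "2 \<le> card A" using w by simp
      then have "is_kernel k (induced_subgraph P A) H"
        using is_kernel_side[OF P(1) \<open>0 < k\<close> bigP A(1) _ A(3)] by blast
      moreover have "card A < card (verts P)" using finP A(1) by (rule psubset_card_mono)
      ultimately have "\<not> verts C \<subseteq> A" using least[of "induced_subgraph P A"] A(2) by auto
      then have AC: "A \<inter> verts C \<subset> verts C" by blast
      have ne: "A \<inter> verts C \<noteq> {}" using w A(2) WC by blast
      have eqC: "crossing C (verts C) T = crossing P (verts C) T" for T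
        using crossing_kernel[OF Ck \<open>0 < k\<close>, of "verts C" T]
          crossing_kernel[OF P(1) \<open>0 < k\<close>, of "verts C" T] P(2) by simp
      have cross: "crossing C (verts C) (A \<inter> verts C) \<subseteq> crossing P (verts P) A"
        unfolding eqC using P(2) by (intro crossing_mono) auto
      have geC: "k \<le> card (crossing C (verts C) (A \<inter> verts C))"
        using edge_maximal_le_crossing[OF Cmax AC ne] .
      have cross_eq: "crossing C (verts C) (A \<inter> verts C) = crossing P (verts P) A"
        using cross geC A(3) by (intro card_seteq finite_crossing[OF simpleP]) simp_all
      have "card (A \<inter> verts C) < 2"
      proof (rule ccontr)
        assume "\<not> ?thesis"
        then have D: "is_kernel k (induced_subgraph C (A \<inter> verts C)) H" (is "is_kernel k ?D H")
          using is_kernel_side[OF Ck \<open>0 < k\<close> big AC] cross_eq A(3) by simp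
        have "?D = C"
        proof (rule least_closure[OF D])
          have simpleD: "simple_graph ?D" using edge_maximal_simple[OF kernel_edge_maximal[OF D]] .
          then show "subgraph ?D C"
            using edge_maximal_simple[OF Cmax] unfolding subgraph_def by (auto simp: induced_subgraph_def)
          have "W \<subseteq> A \<inter> verts C" using A(2) WC by blast
          then show "subgraph (induced_subgraph H W) ?D"
            using sub simpleD unfolding subgraph_def by (auto simp: induced_subgraph_def)
        qed
        then show False using AC by (metis psubsetE subset_refl verts_induced)
      qed
      moreover have "card (A \<inter> verts C) \<noteq> 0" using ne finC by simp
      ultimately have "card (A \<inter> verts C) = 1" by linarith
      then obtain x where x: "A \<inter> verts C = {x}" by (metis One_nat_def card_1_singleton_iff)
      have "W \<subseteq> {x}" using x A(2) WC by blast
      then have Wx: "W = {x}" "x \<noteq> u" using w by blast+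
      have attach: "attach P A = {x}"
      proof -
        have "attach P A \<subseteq> {x}"
        proof
          fix y assume "y \<in> attach P A"
          then obtain z where z: "y \<in> A" "z \<in> verts P - A" "{y, z} \<in> edges P" by (auto simp: attach_def)
          then have "{y, z} \<in> crossing P (verts P) A" using A(1) by (intro crossing_pairI) auto
          then have "{y, z} \<subseteq> verts C" unfolding cross_eq[symmetric] by (simp add: crossing_def)
          then show "y \<in> {x}" using z(1) x by blast
        qed
        moreover have "attach P A \<noteq> {}" using attach_nonempty[OF Pmax \<open>0 < k\<close> A(1)] A(2) by blast
        ultimately show ?thesis by blast
      qed
      obtain z where z: "z \<in> verts P - A" using A(1) by blast
      have uA: "u \<in> A" and zA: "z \<notin> A" and AP: "A \<subseteq> verts P" using z A by auto
      have "u \<notin> attach P A" using attach Wx by simp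
      then have "{u, z} \<notin> edges P" using z uA unfolding attach_def by blast
      then obtain S where S: "linked k P u z S"
        using edge_maximal_linked[OF Pmax, of u z] z uA zA P(2) by blast
      have xS: "x \<in> S" using attach_subset_linked[OF simpleP S AP uA zA] A(3) attach by simp
      have uS: "u \<in> S" using linked_endpoints(1)[OF S] .
      have avoid: "k + 1 \<le> card (crossing P (S \<inter> A) T) + (if u \<in> T then 1 else 0)"
        if "T \<subseteq> S \<inter> A" "T \<noteq> {}" "x \<notin> T" for T
        using linked_side_crossing[OF simpleP S AP uA zA that(1,2)] that(3) attach by simp
      have "anchored k P (insert u W) (S \<inter> A)"
        unfolding anchored_def
      proof (intro conjI allI impI)
        show "S \<inter> A \<subseteq> verts P" "insert u W \<subseteq> S \<inter> A" using AP xS uS A(2) Wx by auto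
        fix T assume T: "T \<subset> S \<inter> A \<and> T \<noteq> {}"
        show "k \<le> card (crossing P (S \<inter> A) T)"
        proof (cases "x \<in> T")
          case True
          \<comment> \<open>The complement of \<open>T\<close> has the same crossing edges and avoids \<open>x\<close>.\<close>
          then have "S \<inter> A - T \<subseteq> S \<inter> A" "S \<inter> A - T \<noteq> {}" "x \<notin> S \<inter> A - T" using T by blast+
          then have "k \<le> card (crossing P (S \<inter> A) (S \<inter> A - T))"
            using avoid[of "S \<inter> A - T"] by (cases "u \<in> S \<inter> A - T") auto
          then show ?thesis using T by (metis crossing_complement psubset_imp_subset)
        next
          case False
          then show ?thesis using avoid[of T] T by (cases "u \<in> T") auto
        qed
        assume "T \<inter> insert u W = {}"
        then show "k + 1 \<le> card (crossing P (S \<inter> A) T)"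
          using avoid[of T] T Wx by auto
      qed
      then show thesis using that anchored_kernel_transfer[OF P(1) \<open>0 < k\<close>] by blast
    qed
  qed
qed

section \<open>Gluing anchored sets along a cut\<close>

text \<open>A set \<open>T\<close> that avoids both \<open>u\<close> and the ends of the cut edges is left by \<open>k + 1\<close> edges inside \<open>S1\<close>.
  Otherwise \<open>k\<close> edges inside \<open>S1\<close> are supplemented by a cut edge into \<open>S2\<close> or by the pair \<open>u\<close>, \<open>v\<close>.\<close>

lemma anchored_union_one_side:
  assumes simple: "simple_graph G" and AB: "A \<union> B = verts G" "A \<inter> B = {}"
    and S1: "anchored k G (insert u (attach G A)) S1" "S1 \<subseteq> A"
    and S2: "insert v (attach G B) \<subseteq> S2" "S2 \<subseteq> B"
    and T: "T \<subset> S1" "T \<noteq> {}"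
  shows "k + 1 \<le> card (crossing G (S1 \<union> S2) T) + (if u \<in> T \<longleftrightarrow> v \<in> T then 0 else 1)"
proof -
  have v: "v \<notin> T" using S1(2) S2 T(1) AB(2) by blast
  have sub: "crossing G S1 T \<subseteq> crossing G (S1 \<union> S2) T" unfolding crossing_def by blast
  then have le: "card (crossing G S1 T) \<le> card (crossing G (S1 \<union> S2) T)"
    using finite_crossing[OF simple] by (rule card_mono[rotated])
  have ge: "k \<le> card (crossing G S1 T)" using anchored_le_crossing[OF S1(1) T] .
  consider "u \<in> T" | "T \<inter> insert u (attach G A) = {}" | "u \<notin> T" "T \<inter> attach G A \<noteq> {}" by blast
  then show ?thesis
  proof cases
    case 1
    then show ?thesis using v le ge by simp
  next
    case 2
    then show ?thesis using anchored_less_crossing[OF S1(1) T] le by simp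
  next
    case 3
    then obtain a where a: "a \<in> T" "a \<in> attach G A" by blast
    then obtain b where b: "a \<in> A" "b \<in> verts G - A" "{a, b} \<in> edges G" by (auto simp: attach_def)
    then have "b \<in> B" "a \<in> verts G - B" "{b, a} \<in> edges G"
      using AB by (auto simp: insert_commute)
    then have "b \<in> attach G B" unfolding attach_def by blast
    then have "b \<in> S2" using S2(1) by blast
    have "b \<notin> S1" using b(2) S1(2) by blast
    then have "{a, b} \<notin> crossing G S1 T" by (simp add: crossing_def)
    then have "k + 1 \<le> card (insert {a, b} (crossing G S1 T))"
      using ge finite_crossing[OF simple] by simp
    also have "\<dots> \<le> card (crossing G (S1 \<union> S2) T)"
    proof (rule card_mono[OF finite_crossing[OF simple]])
      have "a \<in> S1" "b \<notin> T" using a(1) T(1) \<open>b \<notin> S1\<close> by blast+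
      then have "{a, b} \<in> crossing G (S1 \<union> S2) T"
        using a(1) b(3) \<open>b \<in> S2\<close> by (intro crossing_pairI) simp_all
      then show "insert {a, b} (crossing G S1 T) \<subseteq> crossing G (S1 \<union> S2) T" using sub by simp
    qed
    finally show ?thesis by simp
  qed
qed

text \<open>A cut that splits both halves has at least \<open>2 k\<close> edges. A cut that separates the two halves consists of
  the \<open>k\<close> given edges and the pair \<open>u\<close>, \<open>v\<close>. A cut that splits just one half is, up to complementation,
  given by a subset of this half.\<close>

lemma linked_union:
  assumes simple: "simple_graph G" and AB: "A \<union> B = verts G" "A \<inter> B = {}" and "0 < k"
    and cut: "k \<le> card (crossing G (verts G) A)"
    and S1: "anchored k G (insert u (attach G A)) S1" "S1 \<subseteq> A"
    and S2: "anchored k G (insert v (attach G B)) S2" "S2 \<subseteq> B"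
  shows "linked k G u v (S1 \<union> S2)"
proof -
  let ?S = "S1 \<union> S2"
  let ?b = "\<lambda>T. if u \<in> T \<longleftrightarrow> v \<in> T then 0 else 1 :: nat"
  let ?good = "\<lambda>T. k + 1 \<le> card (crossing G ?S T) + ?b T"
  have W1: "insert u (attach G A) \<subseteq> S1" and W2: "insert v (attach G B) \<subseteq> S2"
    using anchored_anchor[OF S1(1)] anchored_anchor[OF S2(1)] .
  have uv: "u \<in> S1" "v \<in> S2" "u \<notin> S2" "v \<notin> S1" using W1 W2 S1(2) S2(2) AB(2) by blast+
  have disj: "S1 \<inter> S2 = {}" using S1(2) S2(2) AB(2) by blast
  have compl: "?good T" if "T \<subseteq> ?S" "?good (?S - T)" for T
  proof -
    have "crossing G ?S (?S - T) = crossing G ?S T" using that(1) by (rule crossing_complement)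
    moreover have "?b (?S - T) = ?b T" using uv by auto
    ultimately show ?thesis using that(2) by simp
  qed
  have one: "?good T" if "T \<subset> S1" "T \<noteq> {}" for T
    using anchored_union_one_side[OF simple AB S1 W2 S2(2) that] .
  have two: "?good T" if "T \<subset> S2" "T \<noteq> {}" for T
  proof -
    have "B \<union> A = verts G" "B \<inter> A = {}" using AB by blast+
    from anchored_union_one_side[OF simple this S2 W1 S1(2) that]
    show ?thesis by (simp add: Un_commute eq_commute)
  qed
  have whole: "?good S1"
  proof -
    have "crossing G (verts G) A \<subseteq> crossing G ?S S1"
    proof
      fix e assume e: "e \<in> crossing G (verts G) A"
      obtain x y where xy: "e = {x, y}" "x \<in> attach G A" "x \<in> A" "y \<in> verts G - A"
        using crossing_verts_pair[OF simple e] by metis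
      have "{x, y} \<in> edges G" using e xy(1) by (simp add: crossing_def)
      moreover from this have "{y, x} \<in> edges G" by (simp add: insert_commute)
      moreover have "y \<in> B" "x \<in> verts G - B" using xy AB by blast+
      ultimately have "y \<in> attach G B" unfolding attach_def by blast
      then have "y \<in> S2" "x \<in> S1" using W1 W2 xy(2) by blast+
      then show "e \<in> crossing G ?S S1"
        using disj \<open>{x, y} \<in> edges G\<close> xy(1) by (auto intro: crossing_pairI)
    qed
    then have "card (crossing G (verts G) A) \<le> card (crossing G ?S S1)"
      using finite_crossing[OF simple] by (rule card_mono[rotated])
    then show ?thesis using cut uv by simp
  qed
  have "?good T" if T: "T \<subset> ?S" "T \<noteq> {}" for T
  proof -
    let ?T1 = "T \<inter> S1" and ?T2 = "T \<inter> S2"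
    consider "?T1 = {}" "?T2 \<noteq> S2" | "?T1 = {}" "?T2 = S2" | "?T1 = S1" "?T2 = {}" | "?T1 = S1" "?T2 \<noteq> {}"
      | "?T1 \<noteq> {}" "?T1 \<noteq> S1" "?T2 = {}" | "?T1 \<noteq> {}" "?T1 \<noteq> S1" "?T2 = S2"
      | "?T1 \<noteq> {}" "?T1 \<noteq> S1" "?T2 \<noteq> {}" "?T2 \<noteq> S2" by argo
    then show ?thesis
    proof cases
      case 1
      then have "T \<subset> S2" using T(1) by blast
      then show ?thesis using two T(2) by blast
    next
      case 2
      then have "?S - T = S1" using T(1) disj by blast
      then show ?thesis using compl[of T] whole T(1) by simp
    next
      case 3
      then have "T = S1" using T(1) by blast
      then show ?thesis using whole by simp
    next
      case 4
      then have "?S - T \<subset> S2" "?S - T \<noteq> {}" using T disj by blast+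
      then show ?thesis using compl[of T] two T(1) by blast
    next
      case 5
      then have "T \<subset> S1" using T(1) by blast
      then show ?thesis using one T(2) by blast
    next
      case 6
      then have "?S - T \<subset> S1" "?S - T \<noteq> {}" using T disj by blast+
      then show ?thesis using compl[of T] one T(1) by blast
    next
      case 7
      then have "?T1 \<subset> S1" "?T2 \<subset> S2" by blast+
      then have "k \<le> card (crossing G S1 ?T1)" "k \<le> card (crossing G S2 ?T2)"
        using 7 anchored_le_crossing[OF S1(1)] anchored_le_crossing[OF S2(1)] by blast+
      moreover have "crossing G S1 ?T1 \<inter> crossing G S2 ?T2 = {}"
        using disj unfolding crossing_def by blast
      then have "card (crossing G S1 ?T1 \<union> crossing G S2 ?T2) =
          card (crossing G S1 ?T1) + card (crossing G S2 ?T2)"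
        using finite_crossing[OF simple] by (intro card_Un_disjoint)
      moreover have "crossing G S1 ?T1 \<union> crossing G S2 ?T2 \<subseteq> crossing G ?S T"
        by (intro Un_least crossing_mono) auto
      then have "card (crossing G S1 ?T1 \<union> crossing G S2 ?T2) \<le> card (crossing G ?S T)"
        using finite_crossing[OF simple] by (rule card_mono[rotated])
      ultimately show ?thesis using \<open>0 < k\<close> by simp
    qed
  qed
  then show ?thesis
    using anchored_subset[OF S1(1)] anchored_subset[OF S2(1)] uv unfolding linked_def by blast
qed

text \<open>The cut itself shows sparseness of sets that meet both sides, and inside a side everything is inherited.
  What remains is to link non-adjacent pairs across the cut.\<close>

lemma edge_maximal_join:
  assumes simple: "simple_graph G" and AB: "A \<union> B = verts G" "A \<inter> B = {}"
    and card: "k + 1 \<le> card (verts G)" and cut: "card (crossing G (verts G) A) \<le> k"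
    and A: "card A = 1 \<or> edge_maximal k (induced_subgraph G A)"
    and B: "card B = 1 \<or> edge_maximal k (induced_subgraph G B)"
    and across: "\<And>u v. u \<in> A \<Longrightarrow> v \<in> B \<Longrightarrow> {u, v} \<notin> edges G \<Longrightarrow> \<exists>S. linked k G u v S"
  shows "edge_maximal k G"
proof -
  have fin: "finite (verts G)" using simple by (simp add: simple_graph_def)
  have sides: "card X = 1 \<or> edge_maximal k (induced_subgraph G X)" "X \<subseteq> verts G" if "X \<in> {A, B}" for X
    using A B AB that by auto
  have small: "finite S \<and> card S \<le> 1" if "S \<subseteq> X" "X \<in> {A, B}" "card X = 1" for S X
  proof -
    have "finite X" using sides(2)[OF that(2)] fin by (rule finite_subset)
    then show ?thesis using card_mono[OF _ that(1)] finite_subset[OF that(1)] that(3) by simp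
  qed
  have sparse_side: "\<exists>T. T \<subset> S \<and> T \<noteq> {} \<and> card (crossing G S T) \<le> k"
    if S: "S \<subseteq> X" "X \<in> {A, B}" "2 \<le> card S" for S X
  proof -
    have "card X \<noteq> 1" using small[OF S(1,2)] S(3) by linarith
    then have max: "edge_maximal k (induced_subgraph G X)" using sides(1)[OF S(2)] by blast
    have "S \<subseteq> verts (induced_subgraph G X)" using S(1) by simp
    then obtain T where "T \<subset> S" "T \<noteq> {}" "card (crossing (induced_subgraph G X) S T) \<le> k"
      using edge_maximal_sparse[OF max _ S(3)] by metis
    then show ?thesis unfolding crossing_induced[OF S(1)] by blast
  qed
  have "\<exists>T. T \<subset> S \<and> T \<noteq> {} \<and> card (crossing G S T) \<le> k"
    if S: "S \<subseteq> verts G" "2 \<le> card S" for S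
  proof -
    consider "S \<subseteq> A" | "S \<subseteq> B" | "A \<inter> S \<noteq> {}" "A \<inter> S \<noteq> S" using S(1) AB by blast
    then show ?thesis
    proof cases
      case 3
      have "card (crossing G S (A \<inter> S)) \<le> card (crossing G (verts G) A)"
        using S(1) by (intro card_mono finite_crossing[OF simple] crossing_mono) simp_all
      then show ?thesis using 3 cut by (intro exI[of _ "A \<inter> S"]) auto
    qed (use sparse_side S(2) in blast)+
  qed
  moreover have "\<exists>S. linked k G u v S"
    if uv: "u \<in> verts G" "v \<in> verts G" "u \<noteq> v" "{u, v} \<notin> edges G" for u v
  proof -
    have same: ?thesis if X: "u \<in> X" "v \<in> X" "X \<in> {A, B}" for X
    proof -
      have "card X \<noteq> 1" using X uv(3) by (auto simp: card_1_singleton_iff)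
      then have max: "edge_maximal k (induced_subgraph G X)" using sides(1)[OF X(3)] by blast
      obtain S where S: "linked k (induced_subgraph G X) u v S"
        using edge_maximal_linked[OF max, of u v] X(1,2) uv(3,4) by (auto simp: induced_subgraph_def)
      then have "S \<subseteq> X" using linked_subset by fastforce
      then show ?thesis using S linked_induced sides(2)[OF X(3)] by metis
    qed
    have swap: "linked k G v u S \<Longrightarrow> linked k G u v S" for S
      unfolding linked_def by (simp add: eq_commute)
    consider "u \<in> A" "v \<in> A" | "u \<in> B" "v \<in> B" | "u \<in> A" "v \<in> B" | "v \<in> A" "u \<in> B"
      using uv AB by blast
    then show ?thesis
    proof cases
      case 3
      then show ?thesis using across uv(4) by blast
    next
      case 4
      then show ?thesis using across[of v u] uv(4) swap by (metis insert_commute)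
    qed (use same in blast)+
  qed
  ultimately show ?thesis using simple card unfolding edge_maximal_iff by blast
qed

section \<open>Complete graphs and closures\<close>

lemma graph_iso_complete_card: "graph_iso C (complete_graph m) \<Longrightarrow> card (verts C) = m"
  unfolding graph_iso_def complete_graph_def using bij_betw_same_card by fastforce

text \<open>Any enumeration of the vertices is an isomorphism.\<close>

lemma complete_graph_isoI:
  assumes simple: "simple_graph C"
    and complete: "\<And>u v. u \<in> verts C \<Longrightarrow> v \<in> verts C \<Longrightarrow> u \<noteq> v \<Longrightarrow> {u, v} \<in> edges C"
  shows "graph_iso C (complete_graph (card (verts C)))"
proof -
  let ?K = "complete_graph (card (verts C))"
  have "finite (verts C)" using simple by (simp add: simple_graph_def)
  then obtain f where f: "bij_betw f (verts C) {0..<card (verts C)}" using ex_bij_betw_finite_nat by blast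
  have K: "{i, j} \<in> edges ?K \<longleftrightarrow> i \<noteq> j" if "i < card (verts C)" "j < card (verts C)" for i j
    using that unfolding complete_graph_def by (auto simp: doubleton_eq_iff)
  have "{u, v} \<in> edges C \<longleftrightarrow> {f u, f v} \<in> edges ?K" if uv: "u \<in> verts C" "v \<in> verts C" for u v
  proof -
    have "f u < card (verts C)" "f v < card (verts C)" using bij_betw_apply[OF f] uv by auto
    moreover have "f u = f v \<longleftrightarrow> u = v" using f uv unfolding bij_betw_def inj_on_def by blast
    moreover have "{u, v} \<in> edges C \<longleftrightarrow> u \<noteq> v"
      using complete[OF uv] simple unfolding simple_graph_def by fastforce
    ultimately show ?thesis using K by simp
  qed
  moreover have "bij_betw f (verts C) (verts ?K)" using f by (simp add: complete_graph_def atLeast0LessThan)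
  ultimately show ?thesis unfolding graph_iso_def by blast
qed

text \<open>In a graph on \<open>k + 1\<close> vertices a missing edge \<open>uv\<close> leaves \<open>u\<close> with degree less than \<open>k\<close>, too small for \<open>u\<close>
  and \<open>v\<close> to be linked.\<close>

lemma edge_maximal_smallest_iso:
  assumes C: "edge_maximal k C" and card: "card (verts C) = k + 1"
  shows "graph_iso C (complete_graph (k + 1))"
proof -
  have simple: "simple_graph C" using C by (rule edge_maximal_simple)
  have fin: "finite (verts C)" using C by (rule edge_maximal_finite)
  have "{u, v} \<in> edges C" if uv: "u \<in> verts C" "v \<in> verts C" "u \<noteq> v" for u v
  proof (rule ccontr)
    assume no: "{u, v} \<notin> edges C"
    then obtain S where S: "linked k C u v S" using edge_maximal_linked[OF C uv] by blast
    have uvS: "u \<in> S" "v \<in> S" using linked_endpoints[OF S] by blast+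
    have SC: "S \<subseteq> verts C" using linked_subset[OF S] .
    have finS: "finite S" using SC fin by (rule finite_subset)
    have "{u} \<subset> S" using uvS uv(3) by blast
    then have deg: "k + 1 \<le> card (crossing C S {u}) + 1"
      using linked_le_crossing[OF S, of "{u}"] uv(3) by simp
    have "crossing C S {u} \<subseteq> (\<lambda>z. {u, z}) ` (S - {u, v})"
    proof
      fix e assume e: "e \<in> crossing C S {u}"
      obtain x z where xz: "e = {x, z}" "x \<in> {u}" "z \<notin> {u}" "z \<in> S"
        using crossing_endpoints[OF simple e] by metis
      moreover have "e \<in> edges C" using e by (simp add: crossing_def)
      ultimately have "z \<in> S - {u, v}" "e = {u, z}" using no by auto
      then show "e \<in> (\<lambda>z. {u, z}) ` (S - {u, v})" by blast
    qed
    then have "card (crossing C S {u}) \<le> card (S - {u, v})"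
      using finS by (intro surj_card_le) auto
    also have "\<dots> = card S - 2" using uvS uv(3) by (subst card_Diff_subset) auto
    finally have "k \<le> card S - 2" using deg by linarith
    moreover have "card S \<le> k + 1" using card_mono[OF fin SC] card by simp
    moreover have "2 \<le> card S" using card_mono[OF finS, of "{u, v}"] uvS uv(3) by simp
    ultimately show False by linarith
  qed
  then show ?thesis using complete_graph_isoI[OF simple] card by metis
qed

text \<open>A kernel that contains \<open>W\<close> and has the fewest vertices is minimal for inclusion because kernels are
  induced subgraphs.\<close>

lemma exists_closure:
  assumes H: "edge_maximal k H" and "0 < k" and W: "W \<subseteq> verts H"
  obtains C where "is_closure k C (induced_subgraph H W) H"
proof -
  have simple: "simple_graph H" using H by (rule edge_maximal_simple)
  have sub: "subgraph (induced_subgraph H W) H"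
    using simple simple_graph_induced[OF simple W] W unfolding subgraph_def
    by (simp add: induced_subgraph_def)
  obtain C where C: "is_kernel k C H" "subgraph (induced_subgraph H W) C"
    and least: "\<And>Q. is_kernel k Q H \<Longrightarrow> subgraph (induced_subgraph H W) Q \<Longrightarrow> card (verts C) \<le> card (verts Q)"
    using minimal_kernel[OF is_kernel_refl[OF H], of "subgraph (induced_subgraph H W)"] sub by blast
  have "D = C" if D: "is_kernel k D H" "subgraph (induced_subgraph H W) D" "subgraph D C" for D
  proof -
    have "verts D \<subseteq> verts C" using D(3) by (simp add: subgraph_def)
    then have "verts D = verts C"
      using least[OF D(1,2)] edge_maximal_finite[OF kernel_edge_maximal[OF C(1)]] by (intro card_seteq)
    then show ?thesis
      using kernel_is_induced[OF D(1) \<open>0 < k\<close>] kernel_is_induced[OF C(1) \<open>0 < k\<close>] by metis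
  qed
  then show thesis using that H sub C unfolding is_closure_def by blast
qed

section \<open>Edge-joins\<close>

lemma edge_maximal_side_closure:
  assumes G: "edge_maximal k G" and k: "2 \<le> k"
    and n: "k + 2 \<le> card (verts G)"
    and A: "A \<subset> verts G" "2 \<le> card A" "2 \<le> card (verts G - A)"
    and cut: "card (crossing G (verts G) A) \<le> k"
    and H: "H = induced_subgraph G A"
  shows "edge_maximal k H" "k + 2 \<le> card (verts H)"
    "\<exists>C. is_closure k C (induced_subgraph H (attach G A)) H \<and> \<not> graph_iso C (complete_graph (k + 1))"
proof -
  have "0 < k" using k by simp
  show max: "edge_maximal k H" unfolding H using edge_maximal_side[OF G \<open>0 < k\<close> n A(1,2) cut] .
  have sub: "attach G A \<subseteq> verts H" unfolding H by (auto simp: attach_def)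
  have large: "card (verts Q) \<noteq> k + 1" if "is_kernel k Q H" "attach G A \<subseteq> verts Q" for Q
    using kernel_at_attach_card[OF G k A cut] that unfolding H by blast
  show "k + 2 \<le> card (verts H)"
    using large[OF is_kernel_refl[OF max] sub] edge_maximal_card[OF max] by simp
  obtain C where C: "is_closure k C (induced_subgraph H (attach G A)) H"
    using exists_closure[OF max \<open>0 < k\<close> sub] .
  then have "is_kernel k C H" "attach G A \<subseteq> verts C"
    unfolding is_closure_def subgraph_def by simp_all
  then have "\<not> graph_iso C (complete_graph (k + 1))"
    using large graph_iso_complete_card by blast
  then show "\<exists>C. is_closure k C (induced_subgraph H (attach G A)) H \<and> \<not> graph_iso C (complete_graph (k + 1))"
    using C by blast
qed

text \<open>The new vertex \<open>u\<close> has \<open>k\<close> different neighbours, so together with \<open>v\<close> there are \<open>k + 1\<close> anchors in \<open>B\<close>,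
  enough for an anchored set without any assumption on closures.\<close>

lemma edge_maximal_add_vertex:
  assumes simple: "simple_graph G" and AB: "A \<union> B = verts G" "A \<inter> B = {}" and "0 < k"
    and n: "k + 1 \<le> card (verts G)" and cut: "card (crossing G (verts G) A) = k"
    and A: "card A = 1" and B: "edge_maximal k (induced_subgraph G B)"
  shows "edge_maximal k G"
proof (rule edge_maximal_join[OF simple AB n])
  fix u v assume uv: "u \<in> A" "v \<in> B" "{u, v} \<notin> edges G"
  have Au: "A = {u}" using A uv(1) by (metis One_nat_def card_1_singleton_iff singletonD)
  have sub: "attach G A \<subseteq> A" "attach G B \<subseteq> B" by (auto simp: attach_def)
  have "insert u (attach G A) = {u}" using sub(1) Au by blast
  moreover have "u \<in> verts G" using uv(1) AB(1) by blast
  then have "anchored k G {u} {u}" by (rule anchored_singleton)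
  ultimately have S1: "anchored k G (insert u (attach G A)) {u}" by metis
  have BV: "B \<subseteq> verts G" using AB(1) by blast
  have VB: "verts G - B = {u}" "verts G - A = B" using AB Au by blast+
  have "crossing G (verts G) B = crossing G (verts G) A"
    using crossing_complement[of A "verts G" G] VB(2) AB(1) by (metis Un_upper1)
  moreover have "crossing G (verts G) B \<subseteq> (\<lambda>x. {x, u}) ` attach G B"
  proof
    fix e assume e: "e \<in> crossing G (verts G) B"
    obtain x y where xy: "e = {x, y}" "x \<in> attach G B" "y \<in> verts G - B"
      using crossing_verts_pair[OF simple e] by metis
    then have "y = u" using VB by blast
    then show "e \<in> (\<lambda>x. {x, u}) ` attach G B" using xy by blast
  qed
  moreover have finB: "finite (attach G B)"
    using sub(2) BV simple by (meson finite_subset simple_graph_def)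
  ultimately have "k \<le> card (attach G B)"
    using cut surj_card_le[OF finB] by metis
  moreover have "v \<notin> attach G B"
    using uv(3) VB(1) unfolding attach_def by (simp add: insert_commute)
  ultimately have "k + 1 \<le> card (insert v (attach G B))" using finB by simp
  moreover have "insert v (attach G B) \<subseteq> verts (induced_subgraph G B)" using sub(2) uv(2) by simp
  ultimately obtain S2 where S2: "anchored k (induced_subgraph G B) (insert v (attach G B)) S2"
    using anchored_large[OF B \<open>0 < k\<close>] by blast
  have "linked k G u v ({u} \<union> S2)"
    using linked_union[OF simple AB \<open>0 < k\<close> _ S1 _ anchored_induced[OF S2 BV]]
      anchored_subset[OF S2] cut uv(1) by simp
  then show "\<exists>S. linked k G u v S" ..
qed (use assms in simp_all)

lemma edge_maximal_glue:
  assumes simple: "simple_graph G" and AB: "A \<union> B = verts G" "A \<inter> B = {}" and "0 < k"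
    and cut: "card (crossing G (verts G) A) = k"
    and H: "H1 = induced_subgraph G A" "H2 = induced_subgraph G B"
    and max: "edge_maximal k H1" "edge_maximal k H2"
    and C1: "is_closure k C1 (induced_subgraph H1 (attach G A)) H1" "\<not> graph_iso C1 (complete_graph (k + 1))"
    and C2: "is_closure k C2 (induced_subgraph H2 (attach G B)) H2" "\<not> graph_iso C2 (complete_graph (k + 1))"
  shows "edge_maximal k G"
proof -
  have big: "k + 2 \<le> card (verts C)"
    if "is_closure k C K H" "\<not> graph_iso C (complete_graph (k + 1))" for C K H :: "'a graph"
  proof -
    have C: "edge_maximal k C" using that(1) by (simp add: is_closure_def is_kernel_def)
    then show ?thesis using edge_maximal_card[OF C] edge_maximal_smallest_iso[OF C] that(2) by fastforce
  qed
  have sides: "A \<subseteq> verts G" "B \<subseteq> verts G" using AB by blast+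
  have fin: "finite (verts G)" using simple by (simp add: simple_graph_def)
  have VA: "verts G - A = B" using AB by blast
  have "card (crossing G (verts G) A) \<noteq> 0" using cut \<open>0 < k\<close> by simp
  then obtain e where e': "e \<in> crossing G (verts G) A" by (metis card.empty ex_in_conv)
  then obtain x y where xy: "e = {x, y}" "x \<in> attach G A" "x \<in> A" "y \<in> verts G - A"
    using crossing_verts_pair[OF simple] by metis
  have e: "e \<in> edges G" using e' by (simp add: crossing_def)
  have "y \<in> B" "x \<in> verts G - B" "{y, x} \<in> edges G"
    using xy e AB VA by (auto simp: insert_commute)
  then have "y \<in> attach G B" unfolding attach_def by blast
  then have ne: "attach G A \<noteq> {}" "attach G B \<noteq> {}" using xy(2) by blast+
  show ?thesis
  proof (rule edge_maximal_join[OF simple AB])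
    have "card (verts H1) \<le> card (verts G)" unfolding H using sides fin by (simp add: card_mono)
    then show "k + 1 \<le> card (verts G)" using edge_maximal_card[OF max(1)] by simp
    fix u v assume uv: "u \<in> A" "v \<in> B"
    obtain S1 where S1: "anchored k H1 (insert u (attach G A)) S1"
      using anchored_closure[OF C1(1) \<open>0 < k\<close> big[OF C1] ne(1)] uv(1) H by auto
    obtain S2 where S2: "anchored k H2 (insert v (attach G B)) S2"
      using anchored_closure[OF C2(1) \<open>0 < k\<close> big[OF C2] ne(2)] uv(2) H by auto
    have "linked k G u v (S1 \<union> S2)"
    proof (rule linked_union[OF simple AB \<open>0 < k\<close>])
      show "anchored k G (insert u (attach G A)) S1" "anchored k G (insert v (attach G B)) S2"
        using S1 S2 unfolding H using anchored_induced sides by blast+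
      show "S1 \<subseteq> A" "S2 \<subseteq> B"
        using anchored_subset[OF S1] anchored_subset[OF S2] unfolding H by simp_all
    qed (use cut in simp)
    then show "\<exists>S. linked k G u v S" ..
  qed (use max cut H in simp_all)
qed

lemma edge_joins_structure:
  assumes "G \<in> edge_joins k H1 H2"
  shows "simple_graph G" "verts H1 \<union> verts H2 = verts G" "verts H1 \<inter> verts H2 = {}"
    "H1 = induced_subgraph G (verts H1)" "H2 = induced_subgraph G (verts H2)"
    "card (crossing G (verts G) (verts H1)) = k"
proof -
  from assms obtain F where G: "G = Graph (verts H1 \<union> verts H2) (edges H1 \<union> edges H2 \<union> F)"
    and s1: "simple_graph H1" and s2: "simple_graph H2" and disj: "verts H1 \<inter> verts H2 = {}"
    and F: "F \<subseteq> {{u, v} | u v. u \<in> verts H1 \<and> v \<in> verts H2}" "card F = k"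
    unfolding edge_joins_def by blast
  have F': "e \<subseteq> verts H1 \<union> verts H2 \<and> card e = 2 \<and> e \<inter> verts H1 \<noteq> {} \<and> e \<inter> verts H2 \<noteq> {}" if "e \<in> F" for e
  proof -
    obtain u v where "e = {u, v}" "u \<in> verts H1" "v \<in> verts H2" using F(1) \<open>e \<in> F\<close> by blast
    moreover from this have "u \<noteq> v" using disj by blast
    ultimately show ?thesis by simp
  qed
  have E1: "e \<subseteq> verts H1" "e \<noteq> {}" if "e \<in> edges H1" for e
    using s1 that unfolding simple_graph_def by auto
  have E2: "e \<subseteq> verts H2" "e \<noteq> {}" if "e \<in> edges H2" for e
    using s2 that unfolding simple_graph_def by auto
  show "verts H1 \<union> verts H2 = verts G" using G by simp
  show "verts H1 \<inter> verts H2 = {}" using disj .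
  show "simple_graph G"
    unfolding simple_graph_def
  proof (intro conjI ballI)
    show "finite (verts G)" using s1 s2 unfolding G simple_graph_def by simp
    fix e assume "e \<in> edges G"
    then consider "e \<in> edges H1" | "e \<in> edges H2" | "e \<in> F" unfolding G by auto
    then have "e \<subseteq> verts H1 \<union> verts H2 \<and> card e = 2"
      using F' s1 s2 unfolding simple_graph_def by cases blast+
    then show "e \<subseteq> verts G" "card e = 2" unfolding G by simp_all
  qed
  have edge: "e \<in> edges G \<longleftrightarrow> e \<in> edges H1 \<or> e \<in> edges H2 \<or> e \<in> F" for e
    unfolding G by simp
  have not1: "\<not> e \<subseteq> verts H1" if "e \<in> edges H2 \<or> e \<in> F" for e
    using that E2[of e] F'[of e] disj by blast
  have not2: "\<not> e \<subseteq> verts H2" if "e \<in> edges H1 \<or> e \<in> F" for e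
    using that E1[of e] F'[of e] disj by blast
  have "{e \<in> edges G. e \<subseteq> verts H1} = edges H1"
    using edge not1 E1(1) by (intro set_eqI) (metis (no_types, lifting) mem_Collect_eq)
  then show "H1 = induced_subgraph G (verts H1)" unfolding induced_subgraph_def by simp
  have "{e \<in> edges G. e \<subseteq> verts H2} = edges H2"
    using edge not2 E2(1) by (intro set_eqI) (metis (no_types, lifting) mem_Collect_eq)
  then show "H2 = induced_subgraph G (verts H2)" unfolding induced_subgraph_def by simp
  have "e \<in> crossing G (verts G) (verts H1) \<longleftrightarrow> e \<in> F" for e
  proof
    assume "e \<in> crossing G (verts G) (verts H1)"
    then have "e \<in> edges G" "e \<inter> verts H1 \<noteq> {}" "\<not> e \<subseteq> verts H1" by (simp_all add: crossing_def)
    then show "e \<in> F" using edge[of e] E1[of e] E2[of e] disj by blast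
  next
    assume "e \<in> F"
    then show "e \<in> crossing G (verts G) (verts H1)"
      using edge[of e] F'[of e] not1[of e] \<open>verts H1 \<union> verts H2 = verts G\<close> by (simp add: crossing_def)
  qed
  then have "crossing G (verts G) (verts H1) = F" by blast
  then show "card (crossing G (verts G) (verts H1)) = k" using F(2) by simp
qed

lemma attachment_verts_eq_attach:
  "verts H \<union> verts H' = verts G \<Longrightarrow> verts H \<inter> verts H' = {} \<Longrightarrow>
    attachment_verts G H H' = attach G (verts H)"
  unfolding attachment_verts_def attach_def by blast

theorem theorem1p5:
  fixes k n :: nat and H1 H2 G :: "'a graph" and V1 V2 :: "'a set"
  assumes "n > k + 1" and "k + 1 > 2"
    and "simple_graph H1" and "simple_graph H2"
    and "verts H1 \<inter> verts H2 = {}"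
    and "max (card (verts H1)) (card (verts H2)) \<ge> k + 1"
    and "G \<in> edge_joins k H1 H2"
    and "card (verts G) = n"
    and "V1 = attachment_verts G H1 H2"
    and "V2 = attachment_verts G H2 H1"
  shows "edge_maximal k G \<longleftrightarrow>
    ((graph_iso H1 (complete_graph 1) \<and> edge_maximal k H2) \<or>
     (graph_iso H2 (complete_graph 1) \<and> edge_maximal k H1)) \<or>
    (edge_maximal k H1 \<and> card (verts H1) \<ge> k + 2 \<and>
     edge_maximal k H2 \<and> card (verts H2) \<ge> k + 2 \<and>
     (\<exists>C. is_closure k C (induced_subgraph H1 V1) H1 \<and> \<not> graph_iso C (complete_graph (k + 1))) \<and>
     (\<exists>C. is_closure k C (induced_subgraph H2 V2) H2 \<and> \<not> graph_iso C (complete_graph (k + 1))))"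
    (is "_ \<longleftrightarrow> ?vertex \<or> ?glue")
proof -
  let ?A = "verts H1" and ?B = "verts H2"
  have simple: "simple_graph G" and AB: "?A \<union> ?B = verts G" "?A \<inter> ?B = {}"
    and H: "H1 = induced_subgraph G ?A" "H2 = induced_subgraph G ?B"
    and cut: "card (crossing G (verts G) ?A) = k" using edge_joins_structure[OF assms(7)] by blast+
  have BA: "?B \<union> ?A = verts G" "?B \<inter> ?A = {}" using AB by blast+
  have k: "2 \<le> k" "0 < k" and n: "k + 2 \<le> card (verts G)" using assms by simp_all
  have V1: "V1 = attach G ?A" and V2: "V2 = attach G ?B"
    using attachment_verts_eq_attach AB BA assms(9,10) by blast+
  have compl: "verts G - ?A = ?B" "verts G - ?B = ?A" using AB by blast+
  have cutB: "card (crossing G (verts G) ?B) = k"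
    using crossing_complement[of ?A "verts G" G] cut compl(1) AB(1) by (metis Un_upper1)
  have fin: "finite ?A" "finite ?B" using assms(3,4) by (simp_all add: simple_graph_def)
  have ne: "?A \<noteq> {}" "?B \<noteq> {}"
    using cut cutB k(2) by (auto simp: crossing_def)
  have proper: "?A \<subset> verts G" "?B \<subset> verts G" using AB ne by blast+
  have cardG: "card (verts G) = card ?A + card ?B"
    using card_Un_disjoint[OF fin AB(2)] AB(1) by simp
  have pos: "card ?A \<noteq> 0" "card ?B \<noteq> 0" using fin ne by simp_all
  have single: "graph_iso H (complete_graph 1) \<longleftrightarrow> card (verts H) = 1" if "simple_graph H" for H :: "'a graph"
  proof
    assume "card (verts H) = 1"
    moreover from this have "u = v" if "u \<in> verts H" "v \<in> verts H" for u v
      using that by (auto simp: card_1_singleton_iff)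
    ultimately show "graph_iso H (complete_graph 1)"
      using complete_graph_isoI[OF \<open>simple_graph H\<close>] by metis
  qed (rule graph_iso_complete_card)
  show ?thesis
  proof
    assume G: "edge_maximal k G"
    consider "card ?A = 1" | "card ?B = 1" | "2 \<le> card ?A" "2 \<le> card ?B" using pos by linarith
    then show "?vertex \<or> ?glue"
    proof cases
      case 1
      then have "edge_maximal k H2"
        using edge_maximal_side[OF G k(2) n proper(2)] cutB cardG n k H(2) by simp
      then show ?thesis using 1 single[OF assms(3)] by simp
    next
      case 2
      then have "edge_maximal k H1"
        using edge_maximal_side[OF G k(2) n proper(1)] cut cardG n k H(1) by simp
      then show ?thesis using 2 single[OF assms(4)] by simp
    next
      case 3
      note side1 = edge_maximal_side_closure[OF G k(1) n proper(1) 3(1) _ _ H(1)]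
      note side2 = edge_maximal_side_closure[OF G k(1) n proper(2) 3(2) _ _ H(2)]
      have ?glue
        using side1 side2 3 cut cutB unfolding compl V1 V2 by simp
      then show ?thesis ..
    qed
  next
    assume "?vertex \<or> ?glue"
    then consider (left) "card ?A = 1" "edge_maximal k H2" | (right) "card ?B = 1" "edge_maximal k H1"
      | (glue) ?glue using single assms(3,4) by blast
    then show "edge_maximal k G"
    proof cases
      case left
      then show ?thesis using edge_maximal_add_vertex[OF simple AB k(2) _ cut] n H(2) by simp
    next
      case right
      then show ?thesis using edge_maximal_add_vertex[OF simple BA k(2) _ cutB] n H(1) by simp
    next
      case glue
      then show ?thesis
        using edge_maximal_glue[OF simple AB k(2) cut H] unfolding V1 V2 by blast
    qed
  qed
qed

end
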